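(* Let $\mathfrak g$ be of type $A_n,B_n,C_n$ or $D_n$ with Coxeter number $h$, and $k\ge1$, where $k$ is assumed even if $\mathfrak g=A_n$. The weighted quiver associated to the cluster $\mathcal A$-chart of $\mathcal A_{G,\mathbb D^1_k}$ given by the triangulation of the once-punctured disk $\mathbb D^1_k$ into the triangles $T_\ell=(a,m_\ell,m_{\ell+1})$ ($1\le\ell\le k$), with distinguished vertex $m_\ell$ in $T_\ell$ and (in type $A_n$) the quiver $\widetilde{\mathbf J}(\mathbf s_Q(n))$ on $T_\ell$ for $\ell$ odd and $\widetilde{\mathbf J}(\mathbf s^*_Q(n))$ for $\ell$ even, is isomorphic to the quiver $\widetilde Q_{kh/2}(\mathfrak g)$. Under this isomorphism the oriented cycle $P_s$ around the puncture formed by the vertices of Dynkin index $s$ corresponds to the full subquiver of $Q_{kh/2}(\mathfrak g)$ on the vertices $\{v_i^s\mid i\in\mathbb Z_{kh/2}\}$, for every $s\in S$.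
   Context: Weighted quivers. Vertices carry weights $d_i$; $\sigma_{ij}=\#\{i\to j\}-\#\{j\to i\}$, a half arrow contributing $1/2$ (allowed only between frozen vertices). Amalgamation: identify given pairs of frozen vertices of equal weight and add the arrow numbers; the identified vertices become unfrozen when all numbers at them are integral. $S=\{1,\dots,n\}$; the Coxeter quiver is $n\to n-1\to\cdots\to1$ for $A_n,B_n,C_n$ and $n\to\cdots\to4\to3$, $3\to1$, $3\to2$ for $D_n$; weights $d_s=1$ except $d_s=2$ for $s\ge2$ in type $B_n$, $d_1=2$ in type $C_n$. $h=n+1,2n,2n,2n-2$. Triangle quivers. For $B_n,C_n,D_n$: $\widetilde{\mathbf J}(\mathbf s_Q(n))$ has vertices $v_i^s$ ($s\in S$, $1\le i\le i_{\max}(s)=h/2+1$, weight $d_s$) and $y_j$ ($j\in S$, weight $d_j$); arrows $v^s_i\to v^s_{i+1}$; for each arrow $t\to s$ of the Coxeter quiver, $v^t_i\to v^s_i$ (half arrow for $i=1,h/2+1$) and $v^s_{i+1}\to v^t_i$; types $B,C$: $v^1_2\to y_1\to v^1_1$, $v^n_{i+1}\to y_i\to v^n_i$ ($2\le i\le n$), half arrows $y_i\to y_{i+1}$; type $D$: $v^s_2\to y_s\to v^s_1$ ($s=1,2$), $v^n_i\to y_i\to v^n_{i-1}$ ($3\le i\le n$), half arrows $y_1\to y_3$, $y_2\to y_3$, $y_i\to y_{i+1}$ ($3\le i\le n-1$). For $A_n$: $\widetilde{\mathbf J}(\mathbf s_Q(n))$ has vertices $v_i^s$ ($1\le i\le i_{\max}(s)=n+2-s$)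 and $y_j$; arrows $v_i^s\to v^s_{i+1}$, $v^{s+1}_i\to v^s_i$ ($1\le i\le n+1-s$, half for $i=1$), $v^s_{i+1}\to v^{s+1}_i$ ($1\le i\le n+1-s$, half for $i=n+1-s$), $v^1_{i+1}\to y_i\to v^1_i$, half arrows $y_i\to y_{i+1}$; $\widetilde{\mathbf J}(\mathbf s_Q^*(n))$ is the same quiver with $v_i^s$ renamed $u_i^{n+1-s}$ and $y_j$ renamed $y'_j$ (so $u_i^s$, $1\le i\le s+1$). The $y$'s and the first and last vertex of each row are frozen. The Dynkin index of $v_i^s$ or $u_i^s$ is $s$. The chart. $\mathcal A_{G,\mathbb D_k^1}$ is the moduli space of decorated twisted $G$-local systems on the once-punctured disk with puncture $a$ and special points $m_1,\dots,m_k$ (indices mod $k$) in the order against the boundary orientation, $G$ simply connected with Lie algebra $\mathfrak g$. To the triangle $T_\ell$ one attaches a copy of the triangle quiver, its vertices marked with superscript $(\ell)$, each vertex carrying a function of the configuration of decorated flags at $(m_\ell,m_{\ell+1},a)$; the functions at $y_j$ (or $y'_j$) depend only on the flags at $m_\ell,m_{\ell+1}$, those at the first vertices $v_1^s$ (or $u_1^s$) only on the flags at $m_\ell,a$ and those at the last vertices only on the flags at $m_{\ell+1},a$; for these the function at the first vertex of row $s$ on $T_\ell$ equals the function at the last vertex of row $s$ on $T_{\ell-1}$. The quiver associated to the chart is the amalgamation of the triangle quivers over $\ell\in\mathbb Z_k$ identifying the last vertex of row $s$ on $T_{\ell-1}$ with the first vertex of row $s$ on $T_\ell$, for all $s,\ell$.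 The arrows $v_i^s\to v_{i+1}^s$ (and $u_i^s\to u^s_{i+1}$) then form the oriented cycle $P_s$. Target quiver. $Q_m(\mathfrak g)$ has vertices $v_i^s$ ($s\in S$, $i\in\mathbb Z_m=\mathbb Z/m\mathbb Z$) of weight $d_s$, arrows $v_i^s\to v_{i+1}^s$ (which cancel for $m=2$) and, for each arrow $t\to s$ of the Coxeter quiver, $v_i^t\to v_i^s$ and $v_{i+1}^s\to v_i^t$. For types $B,C,D$, $\widetilde Q_{kh/2}(\mathfrak g)$ is $Q_{kh/2}(\mathfrak g)$ with frozen vertices $y_j^{(\ell)}$ ($j\in S$, $1\le\ell\le k$, weight $d_j$) added with, for $o=(\ell-1)h/2$: types $B,C$: $v^1_{o+2}\to y^{(\ell)}_1\to v^1_{o+1}$, $v^n_{o+i+1}\to y_i^{(\ell)}\to v^n_{o+i}$ ($2\le i\le n$), half arrows $y^{(\ell)}_i\to y^{(\ell)}_{i+1}$; type $D$: $v^s_{o+2}\to y_s^{(\ell)}\to v^s_{o+1}$ ($s=1,2$), $v^n_{o+i}\to y_i^{(\ell)}\to v^n_{o+i-1}$ ($3\le i\le n$), half arrows $y^{(\ell)}_1\to y^{(\ell)}_3$, $y^{(\ell)}_2\to y_3^{(\ell)}$, $y_i^{(\ell)}\to y_{i+1}^{(\ell)}$ ($i\ge3$). For $A_n$ and $k=2k'$, $\widetilde Q_{kh/2}(A_n)=\widetilde Q_{k'h}(A_n)$ is $Q_{k'(n+1)}(A_n)$ with frozen vertices $y_i^{(\ell)},y_i'^{(\ell)}$ ($1\le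 i\le n$, $1\le\ell\le k'$) added with, for $o=(\ell-1)(n+1)$: $v^1_{o+i+1}\to y_i^{(\ell)}\to v^1_{o+i}$, $v^n_{o+i+2}\to y_i'^{(\ell)}\to v^n_{o+i+1}$, half arrows $y_i^{(\ell)}\to y_{i+1}^{(\ell)}$, $y_i'^{(\ell)}\to y_{i+1}'^{(\ell)}$. *)

theory Defs
  imports Complex_Main
begin

section \<open>Weighted quivers\<close>

text \<open>The arrows are recorded by the skew-symmetric numbers \<open>sigma i j\<close>, the number of arrows
  from \<open>i\<close> to \<open>j\<close> minus the number of arrows from \<open>j\<close> to \<open>i\<close>, where a half arrow counts 1/2.\<close>

record 'v wquiver =
  verts :: "'v set"
  frozen :: "'v set"
  weight :: "'v \<Rightarrow> nat"
  sigma :: "'v \<Rightarrow> 'v \<Rightarrow> rat"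

text \<open>An entry \<open>(a, b, c)\<close> of an arrow list is an arrow from \<open>a\<close> to \<open>b\<close> contributing \<open>c\<close>
  (1, or 1/2 for a half arrow). Repeated entries add up and opposite arrows cancel.\<close>

type_synonym 'v arrows = "('v \<times> 'v \<times> rat) list"

definition arrow_number :: "'v arrows \<Rightarrow> 'v \<Rightarrow> 'v \<Rightarrow> rat" where
  "arrow_number as i j = (\<Sum>(a, b, c) \<leftarrow> as. if a = i \<and> b = j then c else 0)"

definition quiver_of :: "'v set \<Rightarrow> 'v set \<Rightarrow> ('v \<Rightarrow> nat) \<Rightarrow> 'v arrows \<Rightarrow> 'v wquiver" where
  "quiver_of I F d as =
     \<lparr> verts = I, frozen = F, weight = d,
       sigma = (\<lambda>i j. arrow_number as i j - arrow_number as j i) \<rparr>"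

definition full_subquiver :: "'v wquiver \<Rightarrow> 'v set \<Rightarrow> 'v wquiver" where
  "full_subquiver Q I = Q \<lparr> verts := verts Q \<inter> I, frozen := frozen Q \<inter> I \<rparr>"

definition quiver_iso :: "('v \<Rightarrow> 'w) \<Rightarrow> 'v wquiver \<Rightarrow> 'w wquiver \<Rightarrow> bool" where
  "quiver_iso \<phi> Q Q' \<longleftrightarrow>
     bij_betw \<phi> (verts Q) (verts Q') \<and>
     (\<forall>x\<in>verts Q. \<phi> x \<in> frozen Q' \<longleftrightarrow> x \<in> frozen Q) \<and>
     (\<forall>x\<in>verts Q. weight Q' (\<phi> x) = weight Q x) \<and>
     (\<forall>x\<in>verts Q. \<forall>y\<in>verts Q. sigma Q' (\<phi> x) (\<phi> y) = sigma Q x y)"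

definition disjoint_union :: "'l set \<Rightarrow> ('l \<Rightarrow> 'v wquiver) \<Rightarrow> ('l \<times> 'v) wquiver" where
  "disjoint_union L Q =
     \<lparr> verts = (SIGMA l:L. verts (Q l)),
       frozen = (SIGMA l:L. frozen (Q l)),
       weight = (\<lambda>(l, x). weight (Q l) x),
       sigma = (\<lambda>(l, x) (l', y). if l = l' then sigma (Q l) x y else 0) \<rparr>"

text \<open>Amalgamation along a set \<open>R\<close> of pairs of frozen vertices of equal weight. The vertices of
  the result are the classes of the equivalence relation generated by \<open>R\<close>; the weight of a class
  is the common weight of its members. A class is unfrozen if it is not made of frozen vertices, or
  if it takes part in the gluing and all arrow numbers at it are integers.\<close>

definition glue_rel :: "'v wquiver \<Rightarrow> ('v \<times> 'v) set \<Rightarrow> ('v \<times> 'v) set" where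
  "glue_rel Q R = Id_on (verts Q) \<union> (R \<union> R\<inverse>)\<^sup>+"

definition amalgamate :: "'v wquiver \<Rightarrow> ('v \<times> 'v) set \<Rightarrow> 'v set wquiver" where
  "amalgamate Q R =
     (let I = verts Q // glue_rel Q R;
          num = (\<lambda>X Y. \<Sum>x\<in>X. \<Sum>y\<in>Y. sigma Q x y)
      in \<lparr> verts = I,
           frozen = {X \<in> I. X \<subseteq> frozen Q \<and> \<not> (X \<inter> Field R \<noteq> {} \<and> (\<forall>Y\<in>I. num X Y \<in> \<int>))},
           weight = (\<lambda>X. the_elem (weight Q ` X)),
           sigma = num \<rparr>)"


section \<open>Dynkin data\<close>

datatype dynkin_type = An | Bn | Cn | Dn

fun dynkin_rank_ok :: "dynkin_type \<Rightarrow> nat \<Rightarrow> bool" where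
  "dynkin_rank_ok An n \<longleftrightarrow> n \<ge> 1"
| "dynkin_rank_ok Bn n \<longleftrightarrow> n \<ge> 2"
| "dynkin_rank_ok Cn n \<longleftrightarrow> n \<ge> 2"
| "dynkin_rank_ok Dn n \<longleftrightarrow> n \<ge> 4"

fun coxeter_number :: "dynkin_type \<Rightarrow> nat \<Rightarrow> nat" where
  "coxeter_number An n = n + 1"
| "coxeter_number Bn n = 2 * n"
| "coxeter_number Cn n = 2 * n"
| "coxeter_number Dn n = 2 * n - 2"

fun dynkin_weight :: "dynkin_type \<Rightarrow> nat \<Rightarrow> nat" where
  "dynkin_weight An s = 1"
| "dynkin_weight Bn s = (if s \<ge> 2 then 2 else 1)"
| "dynkin_weight Cn s = (if s = 1 then 2 else 1)"
| "dynkin_weight Dn s = 1"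

text \<open>The arrows \<open>(t, s)\<close>, meaning \<open>t \<rightarrow> s\<close>, of the Coxeter quiver on \<open>S = {1..n}\<close>.\<close>

definition coxeter_arrows :: "dynkin_type \<Rightarrow> nat \<Rightarrow> (nat \<times> nat) list" where
  "coxeter_arrows T n =
     (if T = Dn then [(3, 1), (3, 2)] @ [(s + 1, s). s \<leftarrow> [3..<n]]
      else [(s + 1, s). s \<leftarrow> [1..<n]])"

definition y_half_arrows :: "dynkin_type \<Rightarrow> nat \<Rightarrow> (nat \<Rightarrow> 'v) \<Rightarrow> 'v arrows" where
  "y_half_arrows T n y =
     (if T = Dn then [(y 1, y 3, 1/2), (y 2, y 3, 1/2)] @ [(y i, y (i + 1), 1/2). i \<leftarrow> [3..<n]]
      else [(y i, y (i + 1), 1/2). i \<leftarrow> [1..<n]])"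


section \<open>Triangle quivers\<close>

text \<open>\<open>V s i\<close> and \<open>U s i\<close> stand for \<open>v\<^sub>i\<^sup>s\<close> and \<open>u\<^sub>i\<^sup>s\<close>: the row (Dynkin index) comes first.\<close>

datatype tvert = V nat nat | U nat nat | Y nat | Y' nat

fun tweight :: "dynkin_type \<Rightarrow> tvert \<Rightarrow> nat" where
  "tweight T (V s i) = dynkin_weight T s"
| "tweight T (U s i) = dynkin_weight T s"
| "tweight T (Y j) = dynkin_weight T j"
| "tweight T (Y' j) = dynkin_weight T j"

definition i_max :: "dynkin_type \<Rightarrow> nat \<Rightarrow> nat \<Rightarrow> nat" where
  "i_max T n s = (if T = An then n + 2 - s else coxeter_number T n div 2 + 1)"

definition tri_verts :: "dynkin_type \<Rightarrow> nat \<Rightarrow> tvert set" where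
  "tri_verts T n = {V s i | s i. s \<in> {1..n} \<and> i \<in> {1..i_max T n s}} \<union> Y ` {1..n}"

definition tri_frozen :: "dynkin_type \<Rightarrow> nat \<Rightarrow> tvert set" where
  "tri_frozen T n = (\<Union>s\<in>{1..n}. {V s 1, V s (i_max T n s)}) \<union> Y ` {1..n}"

definition tri_row_arrows :: "dynkin_type \<Rightarrow> nat \<Rightarrow> tvert arrows" where
  "tri_row_arrows T n = [(V s i, V s (i + 1), 1). s \<leftarrow> [1..<n+1], i \<leftarrow> [1..<i_max T n s]]"

definition tri_coxeter_arrows :: "dynkin_type \<Rightarrow> nat \<Rightarrow> tvert arrows" where
  "tri_coxeter_arrows T n =
     (if T = An then
        [(V (s + 1) i, V s i, if i = 1 then 1/2 else 1). s \<leftarrow> [1..<n], i \<leftarrow> [1..<n+2-s]] @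
        [(V s (i + 1), V (s + 1) i, if i = n + 1 - s then 1/2 else 1).
           s \<leftarrow> [1..<n], i \<leftarrow> [1..<n+2-s]]
      else
        (let q = coxeter_number T n div 2 in
           [(V t i, V s i, if i = 1 \<or> i = q + 1 then 1/2 else 1).
              (t, s) \<leftarrow> coxeter_arrows T n, i \<leftarrow> [1..<q+2]] @
           [(V s (i + 1), V t i, 1). (t, s) \<leftarrow> coxeter_arrows T n, i \<leftarrow> [1..<q+1]]))"

fun tri_y_arrows :: "dynkin_type \<Rightarrow> nat \<Rightarrow> tvert arrows" where
  "tri_y_arrows An n =
     [(V 1 (i + 1), Y i, 1). i \<leftarrow> [1..<n+1]] @ [(Y i, V 1 i, 1). i \<leftarrow> [1..<n+1]]"
| "tri_y_arrows Dn n =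
     [(V s 2, Y s, 1). s \<leftarrow> [1, 2]] @ [(Y s, V s 1, 1). s \<leftarrow> [1, 2]] @
     [(V n i, Y i, 1). i \<leftarrow> [3..<n+1]] @ [(Y i, V n (i - 1), 1). i \<leftarrow> [3..<n+1]]"
| "tri_y_arrows _ n =
     [(V 1 2, Y 1, 1), (Y 1, V 1 1, 1)] @
     [(V n (i + 1), Y i, 1). i \<leftarrow> [2..<n+1]] @ [(Y i, V n i, 1). i \<leftarrow> [2..<n+1]]"

definition tri_arrows :: "dynkin_type \<Rightarrow> nat \<Rightarrow> tvert arrows" where
  "tri_arrows T n =
     tri_row_arrows T n @ tri_coxeter_arrows T n @ tri_y_arrows T n @ y_half_arrows T n Y"

definition tri_quiver :: "dynkin_type \<Rightarrow> nat \<Rightarrow> tvert wquiver" where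
  "tri_quiver T n = quiver_of (tri_verts T n) (tri_frozen T n) (tweight T) (tri_arrows T n)"

fun star_name :: "nat \<Rightarrow> tvert \<Rightarrow> tvert" where
  "star_name n (V s i) = U (n + 1 - s) i"
| "star_name n (Y j) = Y' j"
| "star_name n x = x"

definition tri_quiver_star :: "nat \<Rightarrow> tvert wquiver" where
  "tri_quiver_star n =
     quiver_of (star_name n ` tri_verts An n) (star_name n ` tri_frozen An n) (tweight An)
       (map (\<lambda>(a, b, c). (star_name n a, star_name n b, c)) (tri_arrows An n))"


section \<open>The quiver of the chart of the once-punctured disk\<close>

text \<open>The triangles \<open>T\<^sub>l = (a, m\<^sub>l, m\<^sub>l\<^sub>+\<^sub>1)\<close> are numbered by \<open>l \<in> {1..k}\<close>, cyclically.\<close>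

definition disk_triangle :: "dynkin_type \<Rightarrow> nat \<Rightarrow> nat \<Rightarrow> tvert wquiver" where
  "disk_triangle T n l = (if T = An \<and> even l then tri_quiver_star n else tri_quiver T n)"

definition row_vert :: "dynkin_type \<Rightarrow> nat \<Rightarrow> nat \<Rightarrow> nat \<Rightarrow> tvert" where
  "row_vert T l s i = (if T = An \<and> even l then U s i else V s i)"

definition row_length :: "dynkin_type \<Rightarrow> nat \<Rightarrow> nat \<Rightarrow> nat \<Rightarrow> nat" where
  "row_length T n l s = (if T = An \<and> even l then s + 1 else i_max T n s)"

definition prev_triangle :: "nat \<Rightarrow> nat \<Rightarrow> nat" where
  "prev_triangle k l = (if l = 1 then k else l - 1)"

definition disk_triangles :: "dynkin_type \<Rightarrow> nat \<Rightarrow> nat \<Rightarrow> (nat \<times> tvert) wquiver" where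
  "disk_triangles T n k = disjoint_union {1..k} (disk_triangle T n)"

text \<open>For \<open>k = 1\<close> the last vertices of the single triangle are glued to its own first vertices.\<close>

definition disk_gluing ::
  "dynkin_type \<Rightarrow> nat \<Rightarrow> nat \<Rightarrow> ((nat \<times> tvert) \<times> (nat \<times> tvert)) set" where
  "disk_gluing T n k =
     (\<lambda>(l, s). let p = prev_triangle k l in
        ((p, row_vert T p s (row_length T n p s)), (l, row_vert T l s 1))) ` ({1..k} \<times> {1..n})"

definition chart_quiver :: "dynkin_type \<Rightarrow> nat \<Rightarrow> nat \<Rightarrow> (nat \<times> tvert) set wquiver" where
  "chart_quiver T n k = amalgamate (disk_triangles T n k) (disk_gluing T n k)"

definition chart_vert ::
  "dynkin_type \<Rightarrow> nat \<Rightarrow> nat \<Rightarrow> nat \<times> tvert \<Rightarrow> (nat \<times> tvert) set" where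
  "chart_vert T n k x = glue_rel (disk_triangles T n k) (disk_gluing T n k) `` {x}"

text \<open>The cycle \<open>P\<^sub>s\<close>: only the arrows \<open>v\<^sub>i\<^sup>s \<rightarrow> v\<^sub>i\<^sub>+\<^sub>1\<^sup>s\<close> and \<open>u\<^sub>i\<^sup>s \<rightarrow> u\<^sub>i\<^sub>+\<^sub>1\<^sup>s\<close> of the triangles are used.\<close>

definition puncture_cycle ::
  "dynkin_type \<Rightarrow> nat \<Rightarrow> nat \<Rightarrow> nat \<Rightarrow> (nat \<times> tvert) set wquiver" where
  "puncture_cycle T n k s =
     (let cv = (\<lambda>l i. chart_vert T n k (l, row_vert T l s i));
          I = {cv l i | l i. l \<in> {1..k} \<and> i \<in> {1..row_length T n l s}}
      in quiver_of I (frozen (chart_quiver T n k) \<inter> I) (weight (chart_quiver T n k))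
           [(cv l i, cv l (i + 1), 1). l \<leftarrow> [1..<k+1], i \<leftarrow> [1..<row_length T n l s]])"


section \<open>The quivers \<open>Q\<^sub>m\<close> and their extension by frozen vertices\<close>

text \<open>\<open>QV s i\<close> stands for \<open>v\<^sub>i\<^sup>s\<close>, where an element of \<open>\<int>/m\<int>\<close> is represented by its
  residue \<open>i < m\<close>; \<open>QY l j\<close> and \<open>QY' l j\<close> carry the superscript \<open>l\<close> first.\<close>

datatype qvert = QV nat nat | QY nat nat | QY' nat nat

fun qweight :: "dynkin_type \<Rightarrow> qvert \<Rightarrow> nat" where
  "qweight T (QV s i) = dynkin_weight T s"
| "qweight T (QY l j) = dynkin_weight T j"
| "qweight T (QY' l j) = dynkin_weight T j"

definition Qm_verts :: "nat \<Rightarrow> nat \<Rightarrow> qvert set" where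
  "Qm_verts n m = {QV s i | s i. s \<in> {1..n} \<and> i < m}"

definition Qm_arrows :: "dynkin_type \<Rightarrow> nat \<Rightarrow> nat \<Rightarrow> qvert arrows" where
  "Qm_arrows T n m =
     [(QV s i, QV s ((i + 1) mod m), 1). s \<leftarrow> [1..<n+1], i \<leftarrow> [0..<m]] @
     [(QV t i, QV s i, 1). (t, s) \<leftarrow> coxeter_arrows T n, i \<leftarrow> [0..<m]] @
     [(QV s ((i + 1) mod m), QV t i, 1). (t, s) \<leftarrow> coxeter_arrows T n, i \<leftarrow> [0..<m]]"

definition Qm :: "dynkin_type \<Rightarrow> nat \<Rightarrow> nat \<Rightarrow> qvert wquiver" where
  "Qm T n m = quiver_of (Qm_verts n m) {} (qweight T) (Qm_arrows T n m)"

text \<open>In type \<open>A\<^sub>n\<close> the superscript runs only up to \<open>k div 2\<close>: each step accounts for two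
  triangles, of which one carries the vertices \<open>y\<close> and the other the vertices \<open>y'\<close>.\<close>

definition Qt_frozen :: "dynkin_type \<Rightarrow> nat \<Rightarrow> nat \<Rightarrow> qvert set" where
  "Qt_frozen T n k =
     (if T = An then
        {QY l j | l j. l \<in> {1..k div 2} \<and> j \<in> {1..n}} \<union>
        {QY' l j | l j. l \<in> {1..k div 2} \<and> j \<in> {1..n}}
      else {QY l j | l j. l \<in> {1..k} \<and> j \<in> {1..n}})"

fun Qt_y_arrows :: "dynkin_type \<Rightarrow> nat \<Rightarrow> nat \<Rightarrow> nat \<Rightarrow> qvert arrows" where
  "Qt_y_arrows An n m l =
     (let o' = (l - 1) * (n + 1); v = (\<lambda>s i. QV s (i mod m)) in
        [(v 1 (o' + i + 1), QY l i, 1). i \<leftarrow> [1..<n+1]] @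
        [(QY l i, v 1 (o' + i), 1). i \<leftarrow> [1..<n+1]] @
        [(v n (o' + i + 2), QY' l i, 1). i \<leftarrow> [1..<n+1]] @
        [(QY' l i, v n (o' + i + 1), 1). i \<leftarrow> [1..<n+1]] @
        y_half_arrows An n (QY l) @ y_half_arrows An n (QY' l))"
| "Qt_y_arrows Dn n m l =
     (let o' = (l - 1) * (coxeter_number Dn n div 2); v = (\<lambda>s i. QV s (i mod m)) in
        [(v s (o' + 2), QY l s, 1). s \<leftarrow> [1, 2]] @
        [(QY l s, v s (o' + 1), 1). s \<leftarrow> [1, 2]] @
        [(v n (o' + i), QY l i, 1). i \<leftarrow> [3..<n+1]] @
        [(QY l i, v n (o' + i - 1), 1). i \<leftarrow> [3..<n+1]] @
        y_half_arrows Dn n (QY l))"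
| "Qt_y_arrows T n m l =
     (let o' = (l - 1) * (coxeter_number T n div 2); v = (\<lambda>s i. QV s (i mod m)) in
        [(v 1 (o' + 2), QY l 1, 1), (QY l 1, v 1 (o' + 1), 1)] @
        [(v n (o' + i + 1), QY l i, 1). i \<leftarrow> [2..<n+1]] @
        [(QY l i, v n (o' + i), 1). i \<leftarrow> [2..<n+1]] @
        y_half_arrows T n (QY l))"

definition Qtilde :: "dynkin_type \<Rightarrow> nat \<Rightarrow> nat \<Rightarrow> qvert wquiver" where
  "Qtilde T n k =
     (let m = k * coxeter_number T n div 2; k' = (if T = An then k div 2 else k) in
        quiver_of (Qm_verts n m \<union> Qt_frozen T n k) (Qt_frozen T n k) (qweight T)
          (Qm_arrows T n m @ concat (map (Qt_y_arrows T n m) [1..<k'+1])))"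

end

theory Submission
  imports Defs
begin

text \<open>Going once around the puncture, the vertices of row \<open>s\<close> form a single cycle of length
  \<open>m = kh/2\<close>: if \<open>p\<^sub>l(s)\<close> (\<open>disk_pos\<close>) is the number of steps made on the triangles before \<open>T\<^sub>l\<close>, then the
  \<open>i\<close>-th vertex of row \<open>s\<close> on \<open>T\<^sub>l\<close> gets the label \<open>v\<^sup>s\<close> with index \<open>p\<^sub>l(s) + i\<close> modulo \<open>m\<close>.
  The gluing classes are exactly the fibres of this labelling, so the arrow numbers of the amalgam are
  those of the labelled arrow lists of the triangles. The latter agree with those of the target quiver
  because two half arrows on a common side of neighbouring triangles have the same labels and the same
  direction. In type \<open>A\<^sub>n\<close> the cut between two neighbouring triangles is skew: on a triangle of odd
  number followed by one of even number the arrows are regrouped, after the reflection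
  \<open>s \<mapsto> n - s\<close> of the Coxeter arrows, into a full block of \<open>n + 1\<close> consecutive indices.\<close>

section \<open>Arrow sums and amalgamation along fibres\<close>

definition push_arrows :: "('v \<Rightarrow> 'w) \<Rightarrow> 'v arrows \<Rightarrow> 'w arrows" where
  "push_arrows f as = map (\<lambda>(a, b, c). (f a, f b, c)) as"

text \<open>Pairing an arrow list with an arbitrary test function \<open>G\<close> turns identities
  of arrow numbers into identities of finite sums. Indicator functions recover the arrow numbers,
  and relabelling the vertices only precomposes \<open>G\<close>.\<close>

definition arrow_sum :: "'v arrows \<Rightarrow> ('v \<Rightarrow> 'v \<Rightarrow> rat) \<Rightarrow> rat" where
  "arrow_sum as G = (\<Sum>(a, b, c) \<leftarrow> as. c * G a b)"

lemma arrow_sum_simps [simp]: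
  "arrow_sum [] G = 0"
  "arrow_sum ((a, b, c) # as) G = c * G a b + arrow_sum as G"
  "arrow_sum (as @ as') G = arrow_sum as G + arrow_sum as' G"
  by (simp_all add: arrow_sum_def)

lemma arrow_sum_concat_map:
  "arrow_sum (concat (map g xs)) G = (\<Sum>x \<leftarrow> xs. arrow_sum (g x) G)"
  by (induction xs) simp_all

lemma arrow_sum_map:
  "arrow_sum (map (\<lambda>x. (a x, b x, c x)) xs) G = (\<Sum>x \<leftarrow> xs. c x * G (a x) (b x))"
  by (induction xs) simp_all

lemma arrow_sum_push: "arrow_sum (push_arrows f as) G = arrow_sum as (\<lambda>x y. G (f x) (f y))"
  unfolding push_arrows_def by (induction as) auto

lemma arrow_number_simps:
  "arrow_number [] i j = 0"
  "arrow_number ((a, b, c) # as) i j = (if a = i \<and> b = j then c else 0) + arrow_number as i j"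
  "arrow_number (as @ as') i j = arrow_number as i j + arrow_number as' i j"
  by (simp_all add: arrow_number_def)

lemma arrow_number_eq_arrow_sum:
  "arrow_number as i j = arrow_sum as (\<lambda>x y. if x = i \<and> y = j then 1 else 0)"
  by (induction as) (auto simp: arrow_number_simps)

lemma arrow_number_eqI:
  assumes "\<And>G. arrow_sum as G = arrow_sum bs G"
  shows "arrow_number as = arrow_number bs"
  using assms by (intro ext) (simp add: arrow_number_eq_arrow_sum)

lemma arrow_number_Ints:
  assumes "\<And>a b c. (a, b, c) \<in> set as \<Longrightarrow> a = i \<Longrightarrow> b = j \<Longrightarrow> c \<in> \<int>"
  shows "arrow_number as i j \<in> \<int>"
  using assms
proof (induction as)
  case (Cons x as)
  then show ?case
    by (cases x) (auto simp: arrow_number_simps)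
qed (simp add: arrow_number_simps)

text \<open>By injectivity, endpoints match after applying \<open>f\<close> exactly if they matched
  before; this transports the arrows of the cycles along the isomorphism.\<close>

lemma arrow_number_push_inj:
  assumes "\<And>a b c. (a, b, c) \<in> set as \<Longrightarrow> a \<in> W \<and> b \<in> W" "inj_on f W" "i \<in> W" "j \<in> W"
  shows "arrow_number (push_arrows f as) (f i) (f j) = arrow_number as i j"
  using assms(1) unfolding push_arrows_def
proof (induction as)
  case (Cons x as)
  obtain a b c where x: "x = (a, b, c)" by (cases x)
  have "a \<in> W" "b \<in> W" using Cons.prems[of a b c] x by auto
  then have "(f a = f i \<and> f b = f j) = (a = i \<and> b = j)"
    using assms(2-4) by (auto simp: inj_on_eq_iff)
  moreover have "arrow_number (map (\<lambda>(a, b, c). (f a, f b, c)) as) (f i) (f j) = arrow_number as i j"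
    using Cons.prems by (intro Cons.IH) auto
  ultimately show ?case by (simp add: x arrow_number_simps)
qed (simp add: arrow_number_simps)

text \<open>An entry from \<open>u\<close> to \<open>v\<close> is counted by the single pair
  \<open>(u, v)\<close>, provided that \<open>f u = a\<close> and \<open>f v = b\<close>. The double
  sum has the shape of the arrow numbers of \<open>amalgamate\<close>.\<close>

lemma arrow_number_push_fibres:
  assumes "finite W" "\<And>x y c. (x, y, c) \<in> set as \<Longrightarrow> x \<in> W \<and> y \<in> W"
  shows "arrow_number (push_arrows f as) a b =
    (\<Sum>x\<in>{x \<in> W. f x = a}. \<Sum>y\<in>{y \<in> W. f y = b}. arrow_number as x y)"
  using assms(2) unfolding push_arrows_def
proof (induction as)
  case (Cons e as)
  obtain u v c where e: "e = (u, v, c)" by (cases e)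
  have uv: "u \<in> W" "v \<in> W" using Cons.prems[of u v c] e by auto
  let ?A = "{x \<in> W. f x = a}" and ?B = "{y \<in> W. f y = b}"
  have fin: "finite ?A" "finite ?B" using assms(1) by auto
  have "(\<Sum>x\<in>?A. \<Sum>y\<in>?B. if u = x \<and> v = y then c else 0) =
        (\<Sum>x\<in>?A. if u = x then (\<Sum>y\<in>?B. if v = y then c else 0) else 0)"
    by (intro sum.cong) auto
  also have "\<dots> = (if f u = a \<and> f v = b then c else 0)"
    using fin uv by (simp add: sum.delta')
  finally have "(\<Sum>x\<in>?A. \<Sum>y\<in>?B. if u = x \<and> v = y then c else 0) =
    (if f u = a \<and> f v = b then c else 0)" .
  moreover have "arrow_number (map (\<lambda>(a, b, c). (f a, f b, c)) as) a b =
      (\<Sum>x\<in>?A. \<Sum>y\<in>?B. arrow_number as x y)"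
    using Cons.prems by (intro Cons.IH) auto
  ultimately show ?case by (simp add: e arrow_number_simps sum.distrib)
qed (simp add: arrow_number_simps)

text \<open>Tagging with \<open>Pair\<close> separates the copies, and distinctness of
  \<open>ls\<close> makes each copy count once.\<close>

lemma arrow_number_disjoint_union:
  assumes "distinct ls" "l \<in> set ls" "l' \<in> set ls"
  shows "arrow_number (concat (map (\<lambda>l. push_arrows (Pair l) (as l)) ls)) (l, x) (l', y) =
    (if l = l' then arrow_number (as l) x y else 0)"
proof -
  have *: "arrow_number (push_arrows (Pair u) bs) (l, x) (l', y) =
      (if u = l \<and> u = l' then arrow_number bs x y else 0)" for u bs
    unfolding push_arrows_def by (induction bs) (auto simp: arrow_number_simps)
  have "arrow_number (concat (map (\<lambda>l. push_arrows (Pair l) (as l)) ls)) (l, x) (l', y) =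
     (\<Sum>u \<leftarrow> ls. if u = l \<and> u = l' then arrow_number (as u) x y else 0)"
    by (induction ls) (simp_all add: arrow_number_simps *)
  also have "\<dots> = (\<Sum>u\<in>set ls. if u = l \<and> u = l' then arrow_number (as u) x y else 0)"
    using assms(1) by (simp add: sum_list_distinct_conv_sum_set)
  also have "\<dots> = (\<Sum>u\<in>set ls. if u = l then (if l = l' then arrow_number (as u) x y else 0) else 0)"
    by (intro sum.cong) auto
  also have "\<dots> = (if l = l' then arrow_number (as l) x y else 0)"
    using assms(2) by simp
  finally show ?thesis .
qed

section \<open>Amalgams whose gluing classes are the fibres of a map\<close>

lemma glue_rel_eq_fibres:
  assumes R: "R \<subseteq> verts Q \<times> verts Q"
    and const: "\<And>x y. (x, y) \<in> R \<Longrightarrow> f x = f y"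
    and conn: "\<And>x y. \<lbrakk>x \<in> verts Q; y \<in> verts Q; f x = f y\<rbrakk> \<Longrightarrow> (x, y) \<in> glue_rel Q R"
  shows "glue_rel Q R = {(x, y). x \<in> verts Q \<and> y \<in> verts Q \<and> f x = f y}"
proof -
  have "x \<in> verts Q \<and> y \<in> verts Q \<and> f x = f y" if "(x, y) \<in> (R \<union> R\<inverse>)\<^sup>+" for x y
    using that by (induction rule: trancl_induct) (use R const in \<open>auto; metis\<close>)+
  then show ?thesis
    using conn by (auto simp: glue_rel_def)
qed

lemma quiver_iso_amalgamate:
  fixes f :: "'v \<Rightarrow> 'w"
  assumes fin: "finite (verts Q)"
    and as: "\<And>x y c. (x, y, c) \<in> set as \<Longrightarrow> x \<in> verts Q \<and> y \<in> verts Q"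
    and sig: "\<And>x y. \<lbrakk>x \<in> verts Q; y \<in> verts Q\<rbrakk> \<Longrightarrow>
      sigma Q x y = arrow_number as x y - arrow_number as y x"
    and glue: "glue_rel Q R = {(x, y). x \<in> verts Q \<and> y \<in> verts Q \<and> f x = f y}"
    and verts': "verts Q' = f ` verts Q"
    and sig': "\<And>a b. sigma Q' a b =
      arrow_number (push_arrows f as) a b - arrow_number (push_arrows f as) b a"
    and wt: "\<And>x. x \<in> verts Q \<Longrightarrow> weight Q' (f x) = weight Q x"
    and froz: "\<And>a. a \<in> verts Q' \<Longrightarrow> a \<in> frozen Q' \<longleftrightarrow>
      {x \<in> verts Q. f x = a} \<subseteq> frozen Q \<and>
      \<not> ({x \<in> verts Q. f x = a} \<inter> Field R \<noteq> {} \<and> (\<forall>b\<in>verts Q'. sigma Q' a b \<in> \<int>))"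
  shows "quiver_iso (\<lambda>X. the_elem (f ` X)) (amalgamate Q R) Q'"
proof -
  define fib where "fib = (\<lambda>a. {x \<in> verts Q. f x = a})"
  \<comment> \<open>Since \<open>f\<close> is constant on a class, the image is a singleton and
    \<open>the_elem\<close> picks the common value.\<close>
  define \<phi> where "\<phi> = (\<lambda>X::'v set. the_elem (f ` X))"
  have im: "f ` fib a = {a}" if "a \<in> verts Q'" for a
    using that by (auto simp: fib_def verts')
  have \<phi>: "\<phi> (fib a) = a" if "a \<in> verts Q'" for a
    using im[OF that] by (simp add: \<phi>_def)
  have "glue_rel Q R `` {x} = fib (f x)" if "x \<in> verts Q" for x
    using that unfolding glue fib_def by auto
  then have I: "verts Q // glue_rel Q R = fib ` verts Q'"
    unfolding quotient_def verts' by auto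
  have wt_fib: "the_elem (weight Q ` fib a) = weight Q' a" if "a \<in> verts Q'" for a
  proof -
    have "weight Q x = weight Q' a" if "x \<in> fib a" for x
      using that wt[of x] by (auto simp: fib_def)
    moreover have "fib a \<noteq> {}"
      using that by (auto simp: fib_def verts')
    ultimately have "weight Q ` fib a = {weight Q' a}" by auto
    then show ?thesis by simp
  qed
  have push: "arrow_number (push_arrows f as) a b = (\<Sum>x\<in>fib a. \<Sum>y\<in>fib b. arrow_number as x y)"
    for a b
    unfolding fib_def using as by (intro arrow_number_push_fibres[OF fin]) blast
  have num: "(\<Sum>x\<in>fib a. \<Sum>y\<in>fib b. sigma Q x y) = sigma Q' a b" for a b
  proof -
    have "(\<Sum>x\<in>fib a. \<Sum>y\<in>fib b. sigma Q x y) =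
        (\<Sum>x\<in>fib a. \<Sum>y\<in>fib b. arrow_number as x y) - (\<Sum>x\<in>fib a. \<Sum>y\<in>fib b. arrow_number as y x)"
      unfolding sum_subtractf[symmetric] by (intro sum.cong) (auto simp: fib_def sig)
    \<comment> \<open>After the swap this is the pushed forward number from \<open>b\<close> to
      \<open>a\<close>.\<close>
    also have "(\<Sum>x\<in>fib a. \<Sum>y\<in>fib b. arrow_number as y x) =
        (\<Sum>y\<in>fib b. \<Sum>x\<in>fib a. arrow_number as y x)"
      by (rule sum.swap)
    finally show ?thesis
      by (simp add: sig' push)
  qed
  have "bij_betw \<phi> (fib ` verts Q') (verts Q')"
    by (auto simp: bij_betw_def inj_on_def image_image \<phi>)
  moreover have "a \<in> frozen Q' \<longleftrightarrow> fib a \<subseteq> frozen Q \<and>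
      \<not> (fib a \<inter> Field R \<noteq> {} \<and> (\<forall>b\<in>verts Q'. sigma Q' a b \<in> \<int>))" if "a \<in> verts Q'" for a
    unfolding fib_def using froz[OF that] .
  ultimately show ?thesis
    unfolding quiver_iso_def amalgamate_def Let_def I \<phi>_def[symmetric]
    by (simp add: \<phi> wt_fib num)
qed


section \<open>Positions around the puncture\<close>

text \<open>In type A, row \<open>s\<close> makes \<open>n + 1 - s\<close> steps on an odd triangle
  and \<open>s\<close> steps on the following even one, hence \<open>n + 1\<close> on the pair; in
  the other types it makes half the Coxeter number on each triangle. For \<open>l \<ge> 1\<close>
  and \<open>s \<le> n\<close> the subtraction does not truncate.\<close>

definition disk_pos :: "dynkin_type \<Rightarrow> nat \<Rightarrow> nat \<Rightarrow> nat \<Rightarrow> nat" where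
  "disk_pos T n l s =
     (if T = An then if even l then l div 2 * (n + 1) - s else l div 2 * (n + 1)
      else (l - 1) * (coxeter_number T n div 2))"

text \<open>Outside type A the number \<open>m\<close> thus splits into \<open>k\<close> blocks of
  half the Coxeter number; in type A the evenness of \<open>k\<close> makes the division by two
  exact.\<close>

lemma two_dvd_coxeter: "T \<noteq> An \<Longrightarrow> coxeter_number T n = 2 * (coxeter_number T n div 2)"
  by (cases T) auto

lemma modulus_pos:
  assumes "dynkin_rank_ok T n" "k \<ge> 1"
  shows "k * coxeter_number T n div 2 > 0"
proof -
  have "coxeter_number T n \<ge> 2" using assms(1) by (cases T) auto
  then have "2 \<le> k * coxeter_number T n"
    using assms(2) mult_le_mono[of 1 k 2 "coxeter_number T n"] by simp
  then show ?thesis by simp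
qed

lemma row_length_ge2:
  assumes "dynkin_rank_ok T n" "s \<in> {1..n}"
  shows "row_length T n l s \<ge> 2"
  using assms by (cases T) (auto simp: row_length_def i_max_def)

lemma disk_pos_1: "disk_pos T n 1 s = 0"
  by (simp add: disk_pos_def)

text \<open>A row with \<open>r\<close> vertices makes \<open>r - 1\<close> steps: the last vertex
  on a triangle and the first one on the next receive the same position.\<close>

lemma disk_pos_Suc:
  assumes "l \<ge> 1" "s \<in> {1..n}"
  shows "disk_pos T n (Suc l) s + 1 = disk_pos T n l s + row_length T n l s"
proof (cases "T = An")
  case True
  show ?thesis
  proof (cases "even l")
    case ev: True
    then obtain j where j: "l = 2 * j" by auto
    \<comment> \<open>As \<open>j\<close> is positive, \<open>j * (n + 1) \<ge> s\<close> and the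
      subtraction in \<open>disk_pos\<close> is exact.\<close>
    then obtain j' where "j = Suc j'" using assms by (cases j) auto
    then show ?thesis using True assms j by (simp add: disk_pos_def row_length_def)
  next
    case False
    then obtain j where "l = 2 * j + 1" by (auto elim: oddE)
    then show ?thesis using True assms by (simp add: disk_pos_def row_length_def i_max_def Suc_diff_le algebra_simps)
  qed
next
  case False
  then show ?thesis using assms
    by (cases l) (auto simp: disk_pos_def row_length_def i_max_def)
qed

lemma disk_pos_end:
  assumes "T = An \<longrightarrow> even k"
  shows "disk_pos T n (Suc k) s = k * coxeter_number T n div 2"
proof (cases "T = An")
  case True
  with assms obtain j where "k = 2 * j" by auto
  with True show ?thesis by (simp add: disk_pos_def)
next
  case False
  then obtain q where "coxeter_number T n = 2 * q"
    using two_dvd_coxeter by blast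
  with False show ?thesis by (simp add: disk_pos_def)
qed

lemma disk_pos_mono:
  assumes "dynkin_rank_ok T n" "s \<in> {1..n}" "1 \<le> l" "l \<le> l'"
  shows "disk_pos T n l s \<le> disk_pos T n l' s"
  using assms(4)
proof (induction rule: dec_induct)
  case (step l')
  with disk_pos_Suc[of l' s n T] row_length_ge2[of T n s l'] assms show ?case by simp
qed simp

text \<open>Without the last vertex of the row, the positions on a triangle run from one past its
  offset up to the offset of the next triangle. These intervals are adjacent and tile the whole
  range.\<close>

lemma sum_disk_pos:
  fixes F :: "nat \<Rightarrow> rat"
  assumes "dynkin_rank_ok T n" "s \<in> {1..n}"
  shows "(\<Sum>l\<in>{1..<Suc k}. \<Sum>i\<in>{1..<row_length T n l s}. F (disk_pos T n l s + i)) =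
         (\<Sum>i\<in>{1..<Suc (disk_pos T n (Suc k) s)}. F i)"
proof (induction k)
  case (Suc k)
  let ?p = "disk_pos T n (Suc k) s" and ?r = "row_length T n (Suc k) s"
  have p: "disk_pos T n (Suc (Suc k)) s + 1 = ?p + ?r"
    using disk_pos_Suc assms(2) by simp
  have r: "?r \<ge> 2" using row_length_ge2 assms by blast
  have "(\<Sum>i\<in>{1..<?r}. F (?p + i)) = (\<Sum>i\<in>{1 + ?p..<?r + ?p}. F i)"
    by (simp add: sum.shift_bounds_nat_ivl[symmetric] add.commute del: sum.op_ivl_Suc)
  also have "{1 + ?p..<?r + ?p} = {Suc ?p..<Suc (disk_pos T n (Suc (Suc k)) s)}"
    using p by (simp add: add.commute)
  finally have "(\<Sum>l\<in>{1..<Suc (Suc k)}. \<Sum>i\<in>{1..<row_length T n l s}. F (disk_pos T n l s + i)) =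
     (\<Sum>i\<in>{1..<Suc ?p}. F i) + (\<Sum>i\<in>{Suc ?p..<Suc (disk_pos T n (Suc (Suc k)) s)}. F i)"
    using Suc by (subst sum.atLeastLessThan_Suc) simp_all
  also have "\<dots> = (\<Sum>i\<in>{1..<Suc (disk_pos T n (Suc (Suc k)) s)}. F i)"
    using p r by (intro sum.atLeastLessThan_concat) auto
  finally show ?case .
qed (simp add: disk_pos_1[unfolded One_nat_def])

text \<open>Positions run from \<open>1\<close> to \<open>m\<close> and residues from
  \<open>0\<close> to \<open>m - 1\<close>; periodicity trades the last term for the one at
  \<open>0\<close>.\<close>

lemma sum_cyclic_shift:
  fixes F :: "nat \<Rightarrow> rat"
  assumes "F m = F 0"
  shows "(\<Sum>i\<in>{1..<Suc m}. F i) = (\<Sum>i\<in>{0..<m}. F i)"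
proof -
  have "(\<Sum>i\<in>{0..<Suc m}. F i) = F 0 + (\<Sum>i\<in>{1..<Suc m}. F i)"
    by (subst sum.atLeast_Suc_lessThan) simp_all
  then show ?thesis using assms by simp
qed

lemma sum_row_cycle:
  fixes F :: "nat \<Rightarrow> rat"
  assumes "dynkin_rank_ok T n" "T = An \<longrightarrow> even k" "s \<in> {1..n}"
    and "F (k * coxeter_number T n div 2) = F 0"
  shows "(\<Sum>l\<in>{1..<Suc k}. \<Sum>i\<in>{1..<row_length T n l s}. F (disk_pos T n l s + i)) =
         (\<Sum>i\<in>{0..<k * coxeter_number T n div 2}. F i)"
  unfolding sum_disk_pos[OF assms(1,3)] disk_pos_end[OF assms(2)]
  by (rule sum_cyclic_shift[OF assms(4)])

text \<open>Existence half of the tiling: a position beyond the offset of the last triangle lies on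
  that triangle.\<close>

lemma ex_disk_pos:
  assumes "dynkin_rank_ok T n" "s \<in> {1..n}" "1 \<le> j" "j \<le> disk_pos T n (Suc k) s"
  obtains l i where "l \<in> {1..k}" "1 \<le> i" "i < row_length T n l s" "j = disk_pos T n l s + i"
  using assms(4)
proof (induction k arbitrary: thesis)
  case 0
  then show ?case using assms(3) by (simp add: disk_pos_1[unfolded One_nat_def])
next
  case (Suc k)
  show ?case
  proof (cases "j \<le> disk_pos T n (Suc k) s")
    case True
    show ?thesis by (rule Suc.IH[OF _ True], rule Suc.prems(1)) auto
  next
    case False
    with Suc.prems(2) disk_pos_Suc[of "Suc k" s n T] assms(2) show ?thesis
      by (intro Suc.prems(1)[of "Suc k" "j - disk_pos T n (Suc k) s"]) auto
  qed
qed

text \<open>Uniqueness half of the tiling: the positions of a triangle stop at the offset of the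
  next one, which is at most that of any later triangle.\<close>

lemma disk_pos_inj:
  assumes "dynkin_rank_ok T n" "s \<in> {1..n}" "l \<ge> 1" "l' \<ge> 1"
    and "1 \<le> i" "i < row_length T n l s" "1 \<le> i'" "i' < row_length T n l' s"
    and "disk_pos T n l s + i = disk_pos T n l' s + i'"
  shows "l = l' \<and> i = i'"
proof -
  have less: False
    if "l < l'" "l \<ge> 1" "i < row_length T n l s" "1 \<le> i'"
       "disk_pos T n l s + i = disk_pos T n l' s + i'" for l l' i i'
    using that disk_pos_Suc[of l s n T] disk_pos_mono[of T n s "Suc l" l'] assms(1,2) by simp
  from less[of l l' i i'] less[of l' l i' i] assms show ?thesis
    by (cases l l' rule: linorder_cases) auto
qed


section \<open>Labelling of the vertices of the triangles\<close>

text \<open>In type A the triangles \<open>2 * j - 1\<close> and \<open>2 * j\<close> carry the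
  vertices y and y' with the common superscript \<open>j\<close>, which the two divisions
  compute.\<close>

fun disk_label :: "dynkin_type \<Rightarrow> nat \<Rightarrow> nat \<Rightarrow> nat \<times> tvert \<Rightarrow> qvert" where
  "disk_label T n k (l, V s i) = QV s ((disk_pos T n l s + i) mod (k * coxeter_number T n div 2))"
| "disk_label T n k (l, U s i) = QV s ((disk_pos T n l s + i) mod (k * coxeter_number T n div 2))"
| "disk_label T n k (l, Y j) = QY (if T = An then Suc l div 2 else l) j"
| "disk_label T n k (l, Y' j) = QY' (l div 2) j"

definition y_vert :: "dynkin_type \<Rightarrow> nat \<Rightarrow> nat \<Rightarrow> tvert" where
  "y_vert T l j = (if T = An \<and> even l then Y' j else Y j)"

definition triangle_arrows :: "dynkin_type \<Rightarrow> nat \<Rightarrow> nat \<Rightarrow> tvert arrows" where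
  "triangle_arrows T n l =
     (if T = An \<and> even l then push_arrows (star_name n) (tri_arrows An n) else tri_arrows T n)"

definition disk_arrows :: "dynkin_type \<Rightarrow> nat \<Rightarrow> nat \<Rightarrow> (nat \<times> tvert) arrows" where
  "disk_arrows T n k = concat (map (\<lambda>l. push_arrows (Pair l) (triangle_arrows T n l)) [1..<Suc k])"

lemma disk_label_row_vert:
  "disk_label T n k (l, row_vert T l s i) =
     QV s ((disk_pos T n l s + i) mod (k * coxeter_number T n div 2))"
  by (simp add: row_vert_def)

lemma row_vert_eq_iff: "row_vert T l s i = row_vert T l s' i' \<longleftrightarrow> s = s' \<and> i = i'"
  by (simp add: row_vert_def)

lemma UN_reflect: "(\<Union>s\<in>{1..n}. f (n + 1 - s)) = (\<Union>s\<in>{1..n::nat}. f s)"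
proof -
  have "(\<lambda>s. n + 1 - s) ` {1..n} = {1..n}"
  proof
    show "{1..n} \<subseteq> (\<lambda>s. n + 1 - s) ` {1..n}"
    proof
      fix s assume "s \<in> {1..n}"
      then show "s \<in> (\<lambda>s. n + 1 - s) ` {1..n}"
        by (intro image_eqI[where x = "n + 1 - s"]) auto
    qed
  qed auto
  then show ?thesis by (metis image_image)
qed

section \<open>Vertices and arrows of the single triangles and of their disjoint union\<close>

lemma verts_disk_triangle:
  "verts (disk_triangle T n l) =
     (\<Union>s\<in>{1..n}. row_vert T l s ` {1..row_length T n l s}) \<union> y_vert T l ` {1..n}"
proof (cases "T = An \<and> even l")
  case True
  have eq: "tri_verts An n = (\<Union>s\<in>{1..n}. V s ` {1..n + 2 - s}) \<union> Y ` {1..n}"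
    by (auto simp: tri_verts_def i_max_def)
  have "star_name n ` tri_verts An n = (\<Union>s\<in>{1..n}. U (n + 1 - s) ` {1..n + 2 - s}) \<union> Y' ` {1..n}"
    by (simp only: eq image_Un image_UN image_image star_name.simps)
  \<comment> \<open>Renaming sends row \<open>s\<close> to row \<open>n + 1 - s\<close>, whose
    length \<open>(n + 1 - s) + 1\<close> is the original \<open>n + 2 - s\<close>.\<close>
  also have "(\<Union>s\<in>{1..n}. U (n + 1 - s) ` {1..n + 2 - s}) =
      (\<Union>s\<in>{1..n}. (\<lambda>s. U s ` {1..s + 1}) (n + 1 - s))"
    by (intro SUP_cong) (auto simp: Suc_diff_le)
  also have "\<dots> = (\<Union>s\<in>{1..n}. U s ` {1..s + 1})"
    by (rule UN_reflect)
  finally have "star_name n ` tri_verts An n = (\<Union>s\<in>{1..n}. U s ` {1..s + 1}) \<union> Y' ` {1..n}" .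
  with True show ?thesis
    by (simp add: disk_triangle_def tri_quiver_star_def quiver_of_def row_vert_def row_length_def
        y_vert_def)
next
  case False
  then show ?thesis
    by (auto simp: disk_triangle_def tri_quiver_def quiver_of_def row_vert_def row_length_def
        y_vert_def tri_verts_def)
qed

lemma frozen_disk_triangle:
  "frozen (disk_triangle T n l) =
     (\<Union>s\<in>{1..n}. row_vert T l s ` {1, row_length T n l s}) \<union> y_vert T l ` {1..n}"
proof (cases "T = An \<and> even l")
  case True
  have eq: "tri_frozen An n = (\<Union>s\<in>{1..n}. V s ` {1, n + 2 - s}) \<union> Y ` {1..n}"
    by (auto simp: tri_frozen_def i_max_def)
  have "star_name n ` tri_frozen An n = (\<Union>s\<in>{1..n}. U (n + 1 - s) ` {1, n + 2 - s}) \<union> Y' ` {1..n}"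
    by (simp only: eq image_Un image_UN image_image star_name.simps)
  also have "(\<Union>s\<in>{1..n}. U (n + 1 - s) ` {1, n + 2 - s}) =
      (\<Union>s\<in>{1..n}. (\<lambda>s. U s ` {1, s + 1}) (n + 1 - s))"
    by (intro SUP_cong) (auto simp: Suc_diff_le)
  also have "\<dots> = (\<Union>s\<in>{1..n}. U s ` {1, s + 1})"
    by (rule UN_reflect)
  finally have "star_name n ` tri_frozen An n = (\<Union>s\<in>{1..n}. U s ` {1, s + 1}) \<union> Y' ` {1..n}" .
  with True show ?thesis
    by (simp add: disk_triangle_def tri_quiver_star_def quiver_of_def row_vert_def row_length_def
        y_vert_def)
next
  case False
  then show ?thesis
    by (auto simp: disk_triangle_def tri_quiver_def quiver_of_def row_vert_def row_length_def
        y_vert_def tri_frozen_def)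
qed

lemma sigma_disk_triangle:
  "sigma (disk_triangle T n l) x y =
     arrow_number (triangle_arrows T n l) x y - arrow_number (triangle_arrows T n l) y x"
  by (simp add: disk_triangle_def tri_quiver_star_def tri_quiver_def quiver_of_def
      triangle_arrows_def push_arrows_def)

lemma weight_disk_triangle: "weight (disk_triangle T n l) = tweight T"
  by (auto simp: disk_triangle_def tri_quiver_star_def tri_quiver_def quiver_of_def)

lemma tri_arrows_verts:
  assumes "dynkin_rank_ok T n" "(x, y, c) \<in> set (tri_arrows T n)"
  shows "x \<in> tri_verts T n \<and> y \<in> tri_verts T n"
proof -
  have "x \<in> tri_verts T n \<and> y \<in> tri_verts T n" if "(x, y, c) \<in> set (tri_row_arrows T n)"
    using that by (auto simp: tri_row_arrows_def tri_verts_def)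
  moreover have "x \<in> tri_verts T n \<and> y \<in> tri_verts T n" if "(x, y, c) \<in> set (tri_coxeter_arrows T n)"
    using that assms(1)
    by (cases T)
       (auto simp: tri_coxeter_arrows_def coxeter_arrows_def tri_verts_def i_max_def Let_def)
  moreover have "x \<in> tri_verts T n \<and> y \<in> tri_verts T n" if "(x, y, c) \<in> set (tri_y_arrows T n)"
    using that assms(1)
    by (cases T) (auto simp: tri_verts_def i_max_def)
  moreover have "x \<in> tri_verts T n \<and> y \<in> tri_verts T n" if "(x, y, c) \<in> set (y_half_arrows T n Y)"
    using that assms(1)
    by (cases T) (auto simp: tri_verts_def y_half_arrows_def)
  ultimately show ?thesis using assms(2) by (auto simp: tri_arrows_def)
qed

lemma triangle_arrows_verts:
  assumes "dynkin_rank_ok T n" "(x, y, c) \<in> set (triangle_arrows T n l)"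
  shows "x \<in> verts (disk_triangle T n l) \<and> y \<in> verts (disk_triangle T n l)"
  using assms tri_arrows_verts[of T n]
  by (fastforce simp: triangle_arrows_def push_arrows_def disk_triangle_def tri_quiver_star_def
      tri_quiver_def quiver_of_def split: if_splits)

lemma disk_verts_cases:
  assumes "x \<in> verts (disk_triangles T n k)"
  obtains (row) l s i where "x = (l, row_vert T l s i)" "l \<in> {1..k}" "s \<in> {1..n}"
      "i \<in> {1..row_length T n l s}"
    | (y) l j where "x = (l, y_vert T l j)" "l \<in> {1..k}" "j \<in> {1..n}"
  using assms by (fastforce simp: disk_triangles_def disjoint_union_def verts_disk_triangle)

lemma row_vert_in_disk:
  "\<lbrakk>l \<in> {1..k}; s \<in> {1..n}; i \<in> {1..row_length T n l s}\<rbrakk> \<Longrightarrow>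
     (l, row_vert T l s i) \<in> verts (disk_triangles T n k)"
  unfolding disk_triangles_def disjoint_union_def verts_disk_triangle
  by (simp del: atLeastAtMost_iff) blast

lemma y_vert_in_disk:
  "\<lbrakk>l \<in> {1..k}; j \<in> {1..n}\<rbrakk> \<Longrightarrow> (l, y_vert T l j) \<in> verts (disk_triangles T n k)"
  by (auto simp: disk_triangles_def disjoint_union_def verts_disk_triangle)

lemma finite_verts_disk_triangles: "finite (verts (disk_triangles T n k))"
  by (auto simp: disk_triangles_def disjoint_union_def verts_disk_triangle)

lemma disk_arrows_verts:
  assumes "dynkin_rank_ok T n" "(x, y, c) \<in> set (disk_arrows T n k)"
  shows "x \<in> verts (disk_triangles T n k) \<and> y \<in> verts (disk_triangles T n k)"
  using assms triangle_arrows_verts[OF assms(1)]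
  by (fastforce simp: disk_arrows_def push_arrows_def disk_triangles_def disjoint_union_def)

lemma sigma_disk_triangles:
  assumes "x \<in> verts (disk_triangles T n k)" "y \<in> verts (disk_triangles T n k)"
  shows "sigma (disk_triangles T n k) x y =
    arrow_number (disk_arrows T n k) x y - arrow_number (disk_arrows T n k) y x"
proof -
  obtain l u l' v where xy: "x = (l, u)" "y = (l', v)" by (cases x, cases y)
  with assms have "l \<in> set [1..<Suc k]" "l' \<in> set [1..<Suc k]"
    by (auto simp: disk_triangles_def disjoint_union_def)
  then show ?thesis
    unfolding disk_arrows_def xy
    by (subst (1 2) arrow_number_disjoint_union)
       (auto simp: disk_triangles_def disjoint_union_def sigma_disk_triangle)
qed

section \<open>The gluing classes are the fibres of the labelling\<close>

lemma disk_gluing_eq: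
  "disk_gluing T n k = (\<Union>l\<in>{1..k}. \<Union>s\<in>{1..n}.
     {((prev_triangle k l, row_vert T (prev_triangle k l) s (row_length T n (prev_triangle k l) s)),
       (l, row_vert T l s 1))})"
  by (auto simp: disk_gluing_def Let_def)

lemma prev_triangle_in: "l \<in> {1..k} \<Longrightarrow> prev_triangle k l \<in> {1..k}"
  by (auto simp: prev_triangle_def)

lemma disk_gluing_verts:
  assumes "dynkin_rank_ok T n"
  shows "disk_gluing T n k \<subseteq> verts (disk_triangles T n k) \<times> verts (disk_triangles T n k)"
proof -
  have "1 \<le> row_length T n l s" if "s \<in> {1..n}" for l s
    using row_length_ge2[OF assms that, of l] by simp
  then have "(prev_triangle k l, row_vert T (prev_triangle k l) s (row_length T n (prev_triangle k l) s))
        \<in> verts (disk_triangles T n k)"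
    and "(l, row_vert T l s 1) \<in> verts (disk_triangles T n k)"
    if "l \<in> {1..k}" "s \<in> {1..n}" for l s
    using that by (auto intro!: row_vert_in_disk prev_triangle_in simp del: One_nat_def)
  then show ?thesis
    unfolding disk_gluing_eq by blast
qed

text \<open>By the recursion for \<open>disk_pos\<close> the end of a row has the position of the
  next start. The first triangle follows the last one, where the total number of steps
  \<open>m\<close> vanishes modulo \<open>m\<close>.\<close>

lemma disk_gluing_label:
  assumes "dynkin_rank_ok T n" "T = An \<longrightarrow> even k" "(x, y) \<in> disk_gluing T n k"
  shows "disk_label T n k x = disk_label T n k y"
proof -
  obtain l s where ls: "l \<in> {1..k}" "s \<in> {1..n}"
    "x = (prev_triangle k l, row_vert T (prev_triangle k l) s (row_length T n (prev_triangle k l) s))"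
    "y = (l, row_vert T l s 1)"
    using assms(3) unfolding disk_gluing_eq by auto
  let ?p = "prev_triangle k l"
  have "disk_pos T n (Suc ?p) s + 1 = disk_pos T n ?p s + row_length T n ?p s"
    using prev_triangle_in[of l k] ls by (intro disk_pos_Suc) auto
  moreover have "(disk_pos T n (Suc ?p) s + 1) mod (k * coxeter_number T n div 2) =
      (disk_pos T n l s + 1) mod (k * coxeter_number T n div 2)"
  proof (cases "l = 1")
    case True
    then show ?thesis
      using disk_pos_end[OF assms(2), of n s] disk_pos_1[of T n s]
        mod_add_self1[of "k * coxeter_number T n div 2" 1]
      by (simp add: prev_triangle_def)
  next
    case False
    then show ?thesis using ls by (simp add: prev_triangle_def)
  qed
  ultimately show ?thesis
    using ls by (simp add: disk_label_row_vert)
qed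

lemma glue_rel_sym: "(x, y) \<in> glue_rel Q R \<Longrightarrow> (y, x) \<in> glue_rel Q R"
proof -
  have "sym ((R \<union> R\<inverse>)\<^sup>+)" by (intro sym_trancl) (auto simp: sym_def)
  then show "(x, y) \<in> glue_rel Q R \<Longrightarrow> (y, x) \<in> glue_rel Q R"
    by (auto simp: glue_rel_def dest: symD)
qed

lemma glue_rel_trans: "\<lbrakk>(x, y) \<in> glue_rel Q R; (y, z) \<in> glue_rel Q R\<rbrakk> \<Longrightarrow> (x, z) \<in> glue_rel Q R"
  by (auto simp: glue_rel_def intro: trancl_trans)

text \<open>On the row vertices which are not the last of their row the labels are injective.\<close>

lemma disk_glue_canonical:
  assumes "dynkin_rank_ok T n" "l \<in> {1..k}" "s \<in> {1..n}" "i \<in> {1..row_length T n l s}"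
  obtains l' i' where "l' \<in> {1..k}" "1 \<le> i'" "i' < row_length T n l' s"
    "((l, row_vert T l s i), (l', row_vert T l' s i'))
       \<in> glue_rel (disk_triangles T n k) (disk_gluing T n k)"
proof (cases "i < row_length T n l s")
  case True
  then show ?thesis
    using assms row_vert_in_disk[OF assms(2-4)] by (intro that[of l i]) (auto simp: glue_rel_def)
next
  case False
  define l' where "l' = (if l = k then 1 else Suc l)"
  have l': "l' \<in> {1..k}" "prev_triangle k l' = l"
    using assms(2) by (auto simp: l'_def prev_triangle_def)
  have "((l, row_vert T l s i), (l', row_vert T l' s 1)) \<in> disk_gluing T n k"
    using False assms(3,4) l' unfolding disk_gluing_eq by fastforce
  then show ?thesis
    using l' row_length_ge2[OF assms(1,3), of l']
    by (intro that[of l' 1]) (auto simp: glue_rel_def)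
qed

text \<open>A label of a y vertex occurs only once. Two row vertices with equal labels are first
  moved inside their classes to vertices that are not last in their row; there the positions lie
  between \<open>1\<close> and \<open>m\<close>, so equal residues force equal positions.\<close>

lemma disk_label_glue:
  assumes "dynkin_rank_ok T n" "T = An \<longrightarrow> even k"
    and x: "x \<in> verts (disk_triangles T n k)" and y: "y \<in> verts (disk_triangles T n k)"
    and eq: "disk_label T n k x = disk_label T n k y"
  shows "(x, y) \<in> glue_rel (disk_triangles T n k) (disk_gluing T n k)"
  using x
proof (cases rule: disk_verts_cases)
  case (y l j)
  have "y = x"
    using assms(4)
  proof (cases rule: disk_verts_cases)
    case (row l' s i)
    then show ?thesis using eq y by (auto simp: y_vert_def disk_label_row_vert split: if_splits)
  next
    case (y l' j')
    \<comment> \<open>In type A the kind of the label gives the parity of \<open>l\<close>, and the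
      superscript then gives \<open>l\<close> itself.\<close>
    with eq \<open>x = (l, y_vert T l j)\<close> show ?thesis
      by (auto simp: y_vert_def split: if_splits) presburger+
  qed
  with x show ?thesis by (auto simp: glue_rel_def)
next
  case (row l s i)
  let ?gl = "glue_rel (disk_triangles T n k) (disk_gluing T n k)"
  let ?m = "k * coxeter_number T n div 2"
  note row_x = row
  from y show ?thesis
  proof (cases rule: disk_verts_cases)
    case (y l' j')
    then show ?thesis using eq row by (auto simp: y_vert_def disk_label_row_vert split: if_splits)
  next
    case (row l' s' i')
    have s: "s' = s" using eq row row_x by (simp add: disk_label_row_vert)
    have lab: "disk_label T n k u = disk_label T n k v" if "(u, v) \<in> ?gl" for u v
    proof -
      have "disk_label T n k u = disk_label T n k v"
        if "(u, v) \<in> (disk_gluing T n k \<union> (disk_gluing T n k)\<inverse>)\<^sup>+" for u v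
        using that by (induction rule: trancl_induct) (auto dest: disk_gluing_label[OF assms(1,2)])
      with that show ?thesis unfolding glue_rel_def by blast
    qed
    obtain a b where ab: "a \<in> {1..k}" "1 \<le> b" "b < row_length T n a s"
      "((l, row_vert T l s i), (a, row_vert T a s b)) \<in> ?gl"
      using disk_glue_canonical[OF assms(1) row_x(2-4)] by blast
    obtain a' b' where ab': "a' \<in> {1..k}" "1 \<le> b'" "b' < row_length T n a' s"
      "((l', row_vert T l' s i'), (a', row_vert T a' s b')) \<in> ?gl"
      using disk_glue_canonical[OF assms(1) row(2-4)] unfolding s by blast
    let ?P = "disk_pos T n a s + b" and ?P' = "disk_pos T n a' s + b'"
    have "?P mod ?m = ?P' mod ?m"
      using lab[OF ab(4)] lab[OF ab'(4)] eq row row_x s by (simp add: disk_label_row_vert)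
    \<comment> \<open>A vertex that is not last has a position bounded by the offset of the next
      triangle, hence by the total \<open>m\<close>.\<close>
    moreover have bound: "disk_pos T n a s + b \<le> ?m"
      if "a \<in> {1..k}" "b < row_length T n a s" for a b
      using that disk_pos_Suc[of a s n T] disk_pos_mono[of T n s "Suc a" "Suc k"]
        disk_pos_end[OF assms(2), of n s] assms(1) row_x(3) by simp
    moreover have "?P \<le> ?m" "?P' \<le> ?m" using bound ab ab' by auto
    \<comment> \<open>Both positions are positive and at most \<open>m\<close>, so residue
      \<open>0\<close> occurs only at \<open>m\<close>.\<close>
    ultimately have "?P = ?P'"
      using ab(2) ab'(2) by (cases "?P = ?m"; cases "?P' = ?m") auto
    then have "a = a' \<and> b = b'"
      using disk_pos_inj[OF assms(1) row_x(3), of a a' b b'] ab ab' by auto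
    then show ?thesis
      using ab(4) ab'(4) row row_x s glue_rel_sym glue_rel_trans by metis
  qed
qed

lemma disk_label_image:
  assumes "dynkin_rank_ok T n" "k \<ge> 1" "T = An \<longrightarrow> even k"
  shows "disk_label T n k ` verts (disk_triangles T n k) =
    Qm_verts n (k * coxeter_number T n div 2) \<union> Qt_frozen T n k" (is "?L = ?R")
proof
  let ?m = "k * coxeter_number T n div 2"
  have "?m > 0" using modulus_pos assms(1,2) by blast
  show "?L \<subseteq> ?R"
  proof
    fix a assume "a \<in> ?L"
    then obtain x where x: "x \<in> verts (disk_triangles T n k)" "a = disk_label T n k x" by blast
    from x(1) show "a \<in> ?R"
    proof (cases rule: disk_verts_cases)
      case (row l s i)
      then show ?thesis using x(2) \<open>?m > 0\<close> by (auto simp: disk_label_row_vert Qm_verts_def)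
    next
      case (y l j)
      have "1 \<le> l div 2" if "even l" using y(2) that by auto
      moreover have "Suc l div 2 \<le> k div 2" if "T = An" "odd l"
        using y(2) that assms(3) by (auto elim!: oddE evenE)
      moreover have "l div 2 \<le> k div 2" using y(2) by (simp add: div_le_mono)
      ultimately show ?thesis using x(2) y by (auto simp: y_vert_def Qt_frozen_def)
    qed
  qed
  show "?R \<subseteq> ?L"
  proof
    fix a assume "a \<in> ?R"
    then consider s i where "a = QV s i" "s \<in> {1..n}" "i < ?m"
      | l j where "T = An" "a = QY l j" "l \<in> {1..k div 2}" "j \<in> {1..n}"
      | l j where "T = An" "a = QY' l j" "l \<in> {1..k div 2}" "j \<in> {1..n}"
      | l j where "T \<noteq> An" "a = QY l j" "l \<in> {1..k}" "j \<in> {1..n}"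
      by (auto simp: Qm_verts_def Qt_frozen_def split: if_splits)
    then show "a \<in> ?L"
    proof cases
      case (1 s i)
      \<comment> \<open>Positions start at \<open>1\<close>, so residue \<open>0\<close> is reached
        at the end of the turn, at position \<open>m\<close>.\<close>
      define j where "j = (if i = 0 then ?m else i)"
      have j: "1 \<le> j" "j \<le> disk_pos T n (Suc k) s" "j mod ?m = i"
        using 1 disk_pos_end[OF assms(3), of n s] by (auto simp: j_def)
      obtain l i' where "l \<in> {1..k}" "1 \<le> i'" "i' < row_length T n l s" "j = disk_pos T n l s + i'"
        using ex_disk_pos[OF assms(1) 1(2) j(1,2)] by blast
      with 1 j(3) show ?thesis
        by (intro image_eqI[where x = "(l, row_vert T l s i')"])
           (auto simp: disk_label_row_vert intro!: row_vert_in_disk)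
    next
      case (2 l j)
      then have "2 * l - 1 \<in> {1..k}" by auto
      from y_vert_in_disk[OF this 2(4), of T] 2 show ?thesis
        by (intro image_eqI[where x = "(2 * l - 1, y_vert T (2 * l - 1) j)"]) (auto simp: y_vert_def)
    next
      case (3 l j)
      then have "2 * l \<in> {1..k}" by auto
      from y_vert_in_disk[OF this 3(4), of T] 3 show ?thesis
        by (intro image_eqI[where x = "(2 * l, y_vert T (2 * l) j)"]) (auto simp: y_vert_def)
    next
      case (4 l j)
      then show ?thesis
        using y_vert_in_disk[of l k j n T]
        by (intro image_eqI[where x = "(l, y_vert T l j)"]) (auto simp: y_vert_def)
    qed
  qed
qed


section \<open>Rows and Coxeter arrows of the disk\<close>

lemma arrow_sum_map_upt:
  "arrow_sum (map (\<lambda>i. (a i, b i, c i)) [x..<y]) G = (\<Sum>i\<in>{x..<y}. c i * G (a i) (b i))"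
  by (simp add: arrow_sum_map interv_sum_list_conv_sum_set_nat)

lemma arrow_sum_concat_upt:
  "arrow_sum (concat (map g [x..<y])) G = (\<Sum>i\<in>{x..<y}. arrow_sum (g i) G)"
  by (simp add: arrow_sum_concat_map interv_sum_list_conv_sum_set_nat)

lemma sum_shift_from_1:
  fixes F :: "nat \<Rightarrow> rat"
  shows "(\<Sum>i\<in>{1..<Suc a}. F i) + (\<Sum>i\<in>{1..<Suc b}. F (a + i)) = (\<Sum>i\<in>{1..<Suc (a + b)}. F i)"
  by (induction b) simp_all

lemma sum_half_first:
  fixes F :: "nat \<Rightarrow> rat"
  assumes "b \<ge> 1"
  shows "(\<Sum>i\<in>{1..<Suc b}. (if i = 1 then 1/2 else 1) * F i) = (\<Sum>i\<in>{1..<Suc b}. F i) - F 1 / 2"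
  using assms by (induction b rule: dec_induct) auto

lemma sum_half_last:
  fixes F :: "nat \<Rightarrow> rat"
  assumes "b \<ge> 1"
  shows "(\<Sum>i\<in>{1..<Suc b}. (if i = b then 1/2 else 1) * F i) = (\<Sum>i\<in>{1..<Suc b}. F i) - F b / 2"
proof -
  have "(\<Sum>i\<in>{1..<b}. (if i = b then 1/2 else 1) * F i) = (\<Sum>i\<in>{1..<b}. F i)"
    by (intro sum.cong) auto
  then show ?thesis using assms by simp
qed

text \<open>With both ends halved, \<open>q + 1\<close> terms amount to a full block of
  \<open>q\<close> terms up to half the difference of the ends, a form that telescopes over the
  triangles.\<close>

lemma sum_half_ends:
  fixes F :: "nat \<Rightarrow> rat"
  assumes "q \<ge> 1"
  shows "(\<Sum>i\<in>{1..<Suc (Suc q)}. (if i = 1 \<or> i = q + 1 then 1/2 else 1) * F i) =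
    (\<Sum>i\<in>{1..<Suc q}. F i) + (F (q + 1) - F 1) / 2"
proof -
  have "(\<Sum>i\<in>{1..<Suc q}. (if i = 1 \<or> i = q + 1 then 1/2 else 1) * F i) =
      (\<Sum>i\<in>{1..<Suc q}. (if i = 1 then 1/2 else 1) * F i)"
    by (intro sum.cong) auto
  also have "\<dots> = (\<Sum>i\<in>{1..<Suc q}. F i) - F 1 / 2"
    by (rule sum_half_first[OF assms])
  finally show ?thesis using assms by (simp add: field_simps)
qed

lemma sum_blocks:
  fixes F :: "nat \<Rightarrow> rat"
  shows "(\<Sum>l\<in>{1..<Suc k}. \<Sum>i\<in>{1..<Suc q}. F ((l - 1) * q + i)) = (\<Sum>i\<in>{1..<Suc (k * q)}. F i)"
proof (induction k)
  case (Suc k)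
  have "(\<Sum>l\<in>{1..<Suc (Suc k)}. \<Sum>i\<in>{1..<Suc q}. F ((l - 1) * q + i)) =
      (\<Sum>i\<in>{1..<Suc (k * q)}. F i) + (\<Sum>i\<in>{1..<Suc q}. F (k * q + i))"
    using Suc by simp
  then show ?case by (simp only: sum_shift_from_1) (simp add: add.commute)
qed simp

text \<open>The sum telescopes to half the difference over one full turn, which periodicity makes
  zero.\<close>

lemma sum_block_ends:
  fixes F :: "nat \<Rightarrow> rat"
  assumes "F (k * q + 1) = F 1"
  shows "(\<Sum>l\<in>{1..<Suc k}. (F ((l - 1) * q + (q + 1)) - F ((l - 1) * q + 1)) / 2) = 0"
proof -
  have eq: "(\<Sum>l\<in>{1..<Suc k}. (F ((l - 1) * q + (q + 1)) - F ((l - 1) * q + 1)) / 2) =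
      (F (k * q + 1) - F 1) / 2" for k
    by (induction k) (simp_all add: field_simps)
  show ?thesis unfolding eq assms by simp
qed

lemma sum_pairs:
  fixes X :: "nat \<Rightarrow> rat"
  shows "(\<Sum>l\<in>{1..<Suc (2 * k)}. X l) = (\<Sum>l\<in>{1..<Suc k}. X (2 * l - 1) + X (2 * l))"
  by (induction k) simp_all

text \<open>Renaming rows by \<open>n + 1 - s\<close> exchanges the Coxeter edge between
  \<open>s\<close> and \<open>s + 1\<close> with the one between \<open>n - s\<close> and
  \<open>n + 1 - s\<close>, so edges are reflected by \<open>n - s\<close>.\<close>

lemma sum_reflect:
  fixes K :: "nat \<Rightarrow> rat"
  shows "(\<Sum>s\<in>{1..<n}. K (n - s)) = (\<Sum>s\<in>{1..<n}. K s)"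
  by (rule sum.reindex_bij_witness[of _ "\<lambda>s. n - s" "\<lambda>s. n - s"]) auto

section \<open>Labelled arrows of all triangles, one family at a time\<close>

definition tri_label :: "dynkin_type \<Rightarrow> nat \<Rightarrow> nat \<Rightarrow> nat \<Rightarrow> tvert \<Rightarrow> qvert" where
  "tri_label T n k l x = disk_label T n k (l, if T = An \<and> even l then star_name n x else x)"

lemma tri_label_simps:
  "tri_label T n k l (V s i) =
     (let s' = if T = An \<and> even l then n + 1 - s else s
      in QV s' ((disk_pos T n l s' + i) mod (k * coxeter_number T n div 2)))"
  "tri_label T n k l (Y j) =
     (if T = An then if even l then QY' (l div 2) j else QY (Suc l div 2) j else QY l j)"
  by (simp_all add: tri_label_def Let_def)

text \<open>\<open>tri_label\<close> absorbs the renaming on the starred triangles, so the one list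
  \<open>tri_arrows\<close> serves triangles of both parities.\<close>

lemma arrow_sum_disk:
  "arrow_sum (push_arrows (disk_label T n k) (disk_arrows T n k)) G =
   (\<Sum>l\<in>{1..<Suc k}. arrow_sum (tri_arrows T n) (\<lambda>x y. G (tri_label T n k l x) (tri_label T n k l y)))"
  unfolding arrow_sum_push disk_arrows_def arrow_sum_concat_upt
  by (intro sum.cong refl) (auto simp: triangle_arrows_def arrow_sum_push tri_label_def)

text \<open>Row arrows join consecutive positions, so the tiling of the turn yields each arrow of
  the row cycle once. Reducing the indices modulo \<open>m\<close> makes the summand a periodic
  function on all natural numbers.\<close>

lemma arrow_sum_disk_rows:
  fixes G :: "qvert \<Rightarrow> qvert \<Rightarrow> rat"
  assumes "dynkin_rank_ok T n" "T = An \<longrightarrow> even k"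
  defines "m \<equiv> k * coxeter_number T n div 2"
  shows "(\<Sum>l\<in>{1..<Suc k}. arrow_sum (tri_row_arrows T n)
            (\<lambda>x y. G (tri_label T n k l x) (tri_label T n k l y))) =
         (\<Sum>s\<in>{1..<Suc n}. \<Sum>i\<in>{0..<m}. G (QV s (i mod m)) (QV s ((i + 1) mod m)))"
proof -
  define F where "F = (\<lambda>s j. G (QV s (j mod m)) (QV s ((j + 1) mod m)))"
  have "arrow_sum (tri_row_arrows T n) (\<lambda>x y. G (tri_label T n k l x) (tri_label T n k l y)) =
     (\<Sum>s\<in>{1..<Suc n}. \<Sum>i\<in>{1..<row_length T n l s}. F s (disk_pos T n l s + i))" for l
  proof (cases "T = An \<and> even l")
    case True
    have "arrow_sum (tri_row_arrows T n) (\<lambda>x y. G (tri_label T n k l x) (tri_label T n k l y)) =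
       (\<Sum>s\<in>{1..<Suc n}. \<Sum>i\<in>{1..<n + 2 - s}. F (n + 1 - s) (disk_pos T n l (n + 1 - s) + i))"
      using True unfolding tri_row_arrows_def arrow_sum_concat_upt arrow_sum_map_upt
      by (simp add: i_max_def tri_label_simps Let_def F_def m_def del: sum.op_ivl_Suc)
    \<comment> \<open>The rows are reindexed by \<open>n + 1 - s\<close>, under which
      \<open>n + 2 - s\<close> becomes the length \<open>s + 1\<close>.\<close>
    also have "\<dots> = (\<Sum>s\<in>{1..<Suc n}. \<Sum>i\<in>{1..<row_length T n l s}. F s (disk_pos T n l s + i))"
      by (rule sum.reindex_bij_witness[of _ "\<lambda>s. n + 1 - s" "\<lambda>s. n + 1 - s"])
         (use True in \<open>auto simp: row_length_def Suc_diff_le\<close>)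
    finally show ?thesis .
  next
    case False
    then have "tri_label T n k l (V s i) = QV s ((disk_pos T n l s + i) mod m)" for s i
      by (auto simp: tri_label_simps Let_def m_def)
    then have "arrow_sum (tri_row_arrows T n) (\<lambda>x y. G (tri_label T n k l x) (tri_label T n k l y)) =
       (\<Sum>s\<in>{1..<Suc n}. \<Sum>i\<in>{1..<i_max T n s}. F s (disk_pos T n l s + i))"
      unfolding tri_row_arrows_def arrow_sum_concat_upt arrow_sum_map_upt
      by (simp add: F_def del: sum.op_ivl_Suc)
    moreover have "row_length T n l = i_max T n"
      using False by (auto simp: row_length_def fun_eq_iff)
    ultimately show ?thesis by simp
  qed
  then have "(\<Sum>l\<in>{1..<Suc k}. arrow_sum (tri_row_arrows T n)
      (\<lambda>x y. G (tri_label T n k l x) (tri_label T n k l y))) =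
    (\<Sum>s\<in>{1..<Suc n}. \<Sum>l\<in>{1..<Suc k}. \<Sum>i\<in>{1..<row_length T n l s}. F s (disk_pos T n l s + i))"
    by (simp only:) (rule sum.swap)
  also have "\<dots> = (\<Sum>s\<in>{1..<Suc n}. \<Sum>i\<in>{0..<m}. F s i)"
    unfolding m_def
    using mod_add_self1[of m 1]
    by (intro sum.cong refl sum_row_cycle[OF assms(1,2)]) (auto simp: F_def m_def)
  finally show ?thesis by (simp add: F_def)
qed

lemma arrow_sum_coxeter_pairs:
  "arrow_sum (concat (map (\<lambda>(t, s). map (\<lambda>i. (a t s i, b t s i, c i)) [x..<y]) ps)) G =
   (\<Sum>(t, s) \<leftarrow> ps. \<Sum>i\<in>{x..<y}. c i * G (a t s i) (b t s i))"
proof (induction ps)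
  case (Cons p ps)
  then show ?case by (cases p) (simp add: arrow_sum_map_upt)
qed simp

lemma coxeter_number_div2_pos:
  assumes "T \<noteq> An" "dynkin_rank_ok T n"
  shows "coxeter_number T n div 2 \<ge> 1"
  using assms by (cases T) auto

text \<open>On a triangle the arrows from row \<open>t\<close> to row \<open>s\<close> occupy
  \<open>q + 1\<close> positions, halved at both ends, and the returning arrows exactly
  \<open>q\<close>. The boundary halves cancel around the puncture, leaving \<open>k\<close>
  adjacent blocks of length \<open>q\<close> for either family.\<close>

lemma arrow_sum_disk_coxeter_notA:
  fixes G :: "qvert \<Rightarrow> qvert \<Rightarrow> rat" and k :: nat
  assumes "dynkin_rank_ok T n" "T \<noteq> An"
  defines "m \<equiv> k * coxeter_number T n div 2"
  shows "(\<Sum>l\<in>{1..<Suc k}. arrow_sum (tri_coxeter_arrows T n)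
            (\<lambda>x y. G (tri_label T n k l x) (tri_label T n k l y))) =
         (\<Sum>(t, s) \<leftarrow> coxeter_arrows T n. \<Sum>i\<in>{0..<m}. G (QV t (i mod m)) (QV s (i mod m))) +
         (\<Sum>(t, s) \<leftarrow> coxeter_arrows T n. \<Sum>i\<in>{0..<m}. G (QV s ((i + 1) mod m)) (QV t (i mod m)))"
proof -
  define q where "q = coxeter_number T n div 2"
  have q: "q \<ge> 1" using coxeter_number_div2_pos assms by (simp add: q_def)
  obtain h where "coxeter_number T n = 2 * h" using two_dvd_coxeter[OF assms(2)] by blast
  then have m: "m = k * q" by (simp add: m_def q_def)
  \<comment> \<open>\<open>F1\<close> and \<open>F2\<close> are the two families of arrows along a
    Coxeter edge as functions of the position.\<close>
  define F1 where "F1 = (\<lambda>t s j. G (QV t (j mod m)) (QV s (j mod m)))"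
  define F2 where "F2 = (\<lambda>t s j. G (QV s ((j + 1) mod m)) (QV t (j mod m)))"
  have F1_per: "F1 t s (k * q + 1) = F1 t s 1" "F1 t s m = F1 t s 0" for t s
    using mod_add_self1[of m 1] by (simp_all add: F1_def m)
  have F2_per: "F2 t s m = F2 t s 0" for t s
    using mod_add_self1[of m 1] by (simp add: F2_def)
  have V: "tri_label T n k l (V s i) = QV s (((l - 1) * q + i) mod m)" for l s i
    using assms(2) by (simp add: tri_label_simps disk_pos_def q_def m_def)
  have one: "arrow_sum (tri_coxeter_arrows T n) (\<lambda>x y. G (tri_label T n k l x) (tri_label T n k l y)) =
     (\<Sum>(t, s) \<leftarrow> coxeter_arrows T n. (\<Sum>i\<in>{1..<Suc q}. F1 t s ((l - 1) * q + i)) +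
           (F1 t s ((l - 1) * q + (q + 1)) - F1 t s ((l - 1) * q + 1)) / 2) +
     (\<Sum>(t, s) \<leftarrow> coxeter_arrows T n. \<Sum>i\<in>{1..<Suc q}. F2 t s ((l - 1) * q + i))" for l
  proof -
    have "arrow_sum (tri_coxeter_arrows T n) (\<lambda>x y. G (tri_label T n k l x) (tri_label T n k l y)) =
     (\<Sum>(t, s) \<leftarrow> coxeter_arrows T n. \<Sum>i\<in>{1..<Suc (Suc q)}.
        (if i = 1 \<or> i = q + 1 then 1/2 else 1) * F1 t s ((l - 1) * q + i)) +
     (\<Sum>(t, s) \<leftarrow> coxeter_arrows T n. \<Sum>i\<in>{1..<Suc q}. F2 t s ((l - 1) * q + i))"
      using assms(2)
      by (simp add: tri_coxeter_arrows_def Let_def q_def[symmetric] arrow_sum_coxeter_pairs V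
          F1_def F2_def del: sum.op_ivl_Suc upt_Suc)
    then show ?thesis
      by (simp only: sum_half_ends[OF q])
  qed
  have swap: "(\<Sum>l\<in>L. \<Sum>(t, s) \<leftarrow> ps. X t s l) = (\<Sum>(t, s) \<leftarrow> ps. \<Sum>l\<in>L. X t s l)"
    for L ps and X :: "nat \<Rightarrow> nat \<Rightarrow> nat \<Rightarrow> rat"
    by (induction ps) (auto simp: sum.distrib)
  have "(\<Sum>l\<in>{1..<Suc k}. arrow_sum (tri_coxeter_arrows T n)
            (\<lambda>x y. G (tri_label T n k l x) (tri_label T n k l y))) =
     (\<Sum>(t, s) \<leftarrow> coxeter_arrows T n. \<Sum>i\<in>{1..<Suc m}. F1 t s i) +
     (\<Sum>(t, s) \<leftarrow> coxeter_arrows T n. \<Sum>i\<in>{1..<Suc m}. F2 t s i)"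
    unfolding one sum.distrib swap sum_blocks sum_block_ends[of "F1 _ _", OF F1_per(1)] m by simp
  then show ?thesis
    by (simp only: sum_cyclic_shift[of "F1 _ _", OF F1_per(2)] sum_cyclic_shift[of "F2 _ _", OF F2_per])
       (simp only: F1_def F2_def)
qed

text \<open>The triangles \<open>2 * l - 1\<close> and \<open>2 * l\<close> are treated together.
  Their common cut depends on the row, but jointly they fill the positions from \<open>p + 1\<close>
  to \<open>p + n + 1\<close>, with outer halves that telescope over the pairs.\<close>

lemma arrow_sum_disk_coxeter_A:
  fixes G :: "qvert \<Rightarrow> qvert \<Rightarrow> rat" and k n :: nat
  assumes "k = 2 * k'"
  defines "m \<equiv> k' * (n + 1)"
  shows "(\<Sum>l\<in>{1..<Suc k}. arrow_sum (tri_coxeter_arrows An n)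
            (\<lambda>x y. G (tri_label An n k l x) (tri_label An n k l y))) =
         (\<Sum>s\<in>{1..<n}. \<Sum>i\<in>{0..<m}. G (QV (s + 1) (i mod m)) (QV s (i mod m))) +
         (\<Sum>s\<in>{1..<n}. \<Sum>i\<in>{0..<m}. G (QV s ((i + 1) mod m)) (QV (s + 1) (i mod m)))"
proof -
  define F1 where "F1 = (\<lambda>s j. G (QV (s + 1) (j mod m)) (QV s (j mod m)))"
  define F2 where "F2 = (\<lambda>s j. G (QV s ((j + 1) mod m)) (QV (s + 1) (j mod m)))"
  define X where "X = (\<lambda>l. arrow_sum (tri_coxeter_arrows An n)
            (\<lambda>x y. G (tri_label An n k l x) (tri_label An n k l y)))"
  have mk: "k * (n + 1) div 2 = m" using assms by simp
  have F1_per: "F1 s (k' * (n + 1) + 1) = F1 s 1" "F1 s m = F1 s 0" for s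
    using mod_add_self1[of m 1] by (simp_all add: F1_def m_def)
  have F2_per: "F2 s m = F2 s 0" for s
    using mod_add_self1[of m 1] by (simp add: F2_def)
  have X: "X l =
    (\<Sum>s\<in>{1..<n}. \<Sum>i\<in>{1..<n + 2 - s}. (if i = 1 then 1/2 else 1) *
        G (tri_label An n k l (V (s + 1) i)) (tri_label An n k l (V s i))) +
    (\<Sum>s\<in>{1..<n}. \<Sum>i\<in>{1..<n + 2 - s}. (if i = n + 1 - s then 1/2 else 1) *
        G (tri_label An n k l (V s (i + 1))) (tri_label An n k l (V (s + 1) i)))" for l
    by (simp add: X_def tri_coxeter_arrows_def arrow_sum_concat_upt arrow_sum_map_upt
        del: upt_Suc sum.op_ivl_Suc)
  have pair: "X (2 * l - 1) + X (2 * l) =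
    (\<Sum>s\<in>{1..<n}. (\<Sum>i\<in>{1..<Suc (n + 1)}. F1 s ((l - 1) * (n + 1) + i)) +
        (F1 s ((l - 1) * (n + 1) + (n + 1 + 1)) - F1 s ((l - 1) * (n + 1) + 1)) / 2) +
    (\<Sum>s\<in>{1..<n}. \<Sum>i\<in>{1..<Suc (n + 1)}. F2 s ((l - 1) * (n + 1) + i))"
    if "l \<ge> 1" for l
  proof -
    define p where "p = (l - 1) * (n + 1)"
    have l_eq: "l * (n + 1) = p + (n + 1)" using that by (cases l) (auto simp: p_def)
    have odd: "tri_label An n k (2 * l - 1) (V s i) = QV s ((p + i) mod m)" for s i
    proof -
      have "odd (2 * l - 1)" "(2 * l - 1) div 2 = l - 1" using that by auto
      then show ?thesis using mk by (simp add: tri_label_simps disk_pos_def p_def)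
    qed
    \<comment> \<open>Row \<open>s\<close> of the list becomes row \<open>n + 1 - s\<close>, whose
      offset \<open>l * (n + 1) - (n + 1 - s)\<close> equals \<open>p + s\<close>.\<close>
    have even: "tri_label An n k (2 * l) (V s i) = QV (n + 1 - s) ((p + s + i) mod m)"
      if "s \<le> n" for s i
    proof -
      have "l * (n + 1) - (n + 1 - s) = p + s" using l_eq that by simp
      then show ?thesis using mk by (simp add: tri_label_simps disk_pos_def)
    qed
    have Xodd: "X (2 * l - 1) =
      (\<Sum>s\<in>{1..<n}. (\<Sum>i\<in>{1..<Suc (n + 1 - s)}. F1 s (p + i)) - F1 s (p + 1) / 2) +
      (\<Sum>s\<in>{1..<n}. (\<Sum>i\<in>{1..<Suc (n + 1 - s)}. F2 s (p + i)) - F2 s (p + (n + 1 - s)) / 2)"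
    proof -
      have "X (2 * l - 1) =
        (\<Sum>s\<in>{1..<n}. \<Sum>i\<in>{1..<Suc (n + 1 - s)}. (if i = 1 then 1/2 else 1) * F1 s (p + i)) +
        (\<Sum>s\<in>{1..<n}. \<Sum>i\<in>{1..<Suc (n + 1 - s)}. (if i = n + 1 - s then 1/2 else 1) * F2 s (p + i))"
        unfolding X odd F1_def F2_def
        by (intro arg_cong2[where f = "(+)"] sum.cong refl) (auto simp: Suc_diff_le)
      also have "\<dots> =
        (\<Sum>s\<in>{1..<n}. (\<Sum>i\<in>{1..<Suc (n + 1 - s)}. F1 s (p + i)) - F1 s (p + 1) / 2) +
        (\<Sum>s\<in>{1..<n}. (\<Sum>i\<in>{1..<Suc (n + 1 - s)}. F2 s (p + i)) - F2 s (p + (n + 1 - s)) / 2)"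
        by (intro arg_cong2[where f = "(+)"] sum.cong refl sum_half_first sum_half_last) auto
      finally show ?thesis .
    qed
    \<comment> \<open>The renaming exchanges the two families. Arrows from row \<open>s + 1\<close>
      to row \<open>s\<close> of the list now lead from row \<open>n - s\<close> to row
      \<open>n + 1 - s\<close>; the offset of the former is larger by one, so they belong to
      \<open>F2\<close>. Likewise the other family belongs to \<open>F1\<close>.\<close>
    have Xeven: "X (2 * l) =
      (\<Sum>s\<in>{1..<n}. (\<Sum>i\<in>{1..<Suc (s + 1)}. F2 s (p + (n - s) + i)) - F2 s (p + (n - s) + 1) / 2) +
      (\<Sum>s\<in>{1..<n}. (\<Sum>i\<in>{1..<Suc (s + 1)}. F1 s (p + (n + 1 - s) + i)) -
          F1 s (p + (n + 1 - s) + (s + 1)) / 2)"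
    proof -
      have "X (2 * l) =
        (\<Sum>s\<in>{1..<n}. \<Sum>i\<in>{1..<Suc (n - s + 1)}. (if i = 1 then 1/2 else 1) *
            F2 (n - s) (p + (n - (n - s)) + i)) +
        (\<Sum>s\<in>{1..<n}. \<Sum>i\<in>{1..<Suc (n - s + 1)}. (if i = n - s + 1 then 1/2 else 1) *
            F1 (n - s) (p + (n + 1 - (n - s)) + i))"
        unfolding X F1_def F2_def
        by (intro arg_cong2[where f = "(+)"] sum.cong refl) (auto simp: Suc_diff_le even)
      also have "\<dots> =
        (\<Sum>s\<in>{1..<n}. \<Sum>i\<in>{1..<Suc (s + 1)}. (if i = 1 then 1/2 else 1) * F2 s (p + (n - s) + i)) +
        (\<Sum>s\<in>{1..<n}. \<Sum>i\<in>{1..<Suc (s + 1)}. (if i = s + 1 then 1/2 else 1) *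
            F1 s (p + (n + 1 - s) + i))"
        by (intro arg_cong2[where f = "(+)"] sum_reflect
            [where K = "\<lambda>s. \<Sum>i\<in>{1..<Suc (s + 1)}. (if i = 1 then 1/2 else 1) * F2 s (p + (n - s) + i)"]
            sum_reflect[where K = "\<lambda>s. \<Sum>i\<in>{1..<Suc (s + 1)}. (if i = s + 1 then 1/2 else 1) *
              F1 s (p + (n + 1 - s) + i)"])
      also have "\<dots> =
        (\<Sum>s\<in>{1..<n}. (\<Sum>i\<in>{1..<Suc (s + 1)}. F2 s (p + (n - s) + i)) - F2 s (p + (n - s) + 1) / 2) +
        (\<Sum>s\<in>{1..<n}. (\<Sum>i\<in>{1..<Suc (s + 1)}. F1 s (p + (n + 1 - s) + i)) -
            F1 s (p + (n + 1 - s) + (s + 1)) / 2)"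
        by (intro arg_cong2[where f = "(+)"] sum.cong refl sum_half_first sum_half_last) auto
      finally show ?thesis .
    qed
    \<comment> \<open>The stretches of \<open>n + 1 - s\<close> and \<open>s + 1\<close> positions
      are adjacent, and the halves sit at the outer ends \<open>p + 1\<close> and
      \<open>p + n + 2\<close>.\<close>
    have F1_sum: "((\<Sum>i\<in>{1..<Suc (n + 1 - s)}. F1 s (p + i)) - F1 s (p + 1) / 2) +
        ((\<Sum>i\<in>{1..<Suc (s + 1)}. F1 s (p + (n + 1 - s) + i)) - F1 s (p + (n + 1 - s) + (s + 1)) / 2) =
        (\<Sum>i\<in>{1..<Suc (n + 1)}. F1 s (p + i)) + (F1 s (p + (n + 1 + 1)) - F1 s (p + 1)) / 2"
      if "s \<in> {1..<n}" for s
    proof -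
      have e: "n + 1 - s + (s + 1) = n + 1 + 1" using that by auto
      have "(\<Sum>i\<in>{1..<Suc (n + 1 - s)}. F1 s (p + i)) + (\<Sum>i\<in>{1..<Suc (s + 1)}. F1 s (p + (n + 1 - s) + i)) =
          (\<Sum>i\<in>{1..<Suc (n + 1 + 1)}. F1 s (p + i))"
        using sum_shift_from_1[where F = "\<lambda>i. F1 s (p + i)" and a = "n + 1 - s" and b = "s + 1"]
        unfolding e add.assoc .
      also have "\<dots> = (\<Sum>i\<in>{1..<Suc (n + 1)}. F1 s (p + i)) + F1 s (p + (n + 1 + 1))"
        by simp
      finally show ?thesis
        unfolding add.assoc e by (simp add: field_simps del: sum.op_ivl_Suc)
    qed
    \<comment> \<open>Here the stretches overlap in the position \<open>p + (n + 1 - s)\<close> on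
      the common side of the two triangles, and each contributes one half there.\<close>
    have F2_sum: "((\<Sum>i\<in>{1..<Suc (n + 1 - s)}. F2 s (p + i)) - F2 s (p + (n + 1 - s)) / 2) +
        ((\<Sum>i\<in>{1..<Suc (s + 1)}. F2 s (p + (n - s) + i)) - F2 s (p + (n - s) + 1) / 2) =
        (\<Sum>i\<in>{1..<Suc (n + 1)}. F2 s (p + i))"
      if "s \<in> {1..<n}" for s
    proof -
      have e: "n + 1 - s + s = n + 1" "n - s + 1 = n + 1 - s" using that by auto
      \<comment> \<open>Splitting off the overlapping position leaves a stretch adjacent to the
        first one.\<close>
      have "(\<Sum>i\<in>{1..<Suc (s + 1)}. F2 s (p + (n - s) + i)) =
          F2 s (p + (n - s) + 1) + (\<Sum>i\<in>{1..<Suc s}. F2 s (p + (n - s) + (i + 1)))"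
        by (subst sum.atLeast_Suc_lessThan) (simp_all add: sum.shift_bounds_Suc_ivl del: sum.op_ivl_Suc)
      also have "\<dots> = F2 s (p + (n + 1 - s)) + (\<Sum>i\<in>{1..<Suc s}. F2 s (p + (n + 1 - s) + i))"
        unfolding e(2)[symmetric] by (simp add: ac_simps del: sum.op_ivl_Suc)
      finally have "(\<Sum>i\<in>{1..<Suc (s + 1)}. F2 s (p + (n - s) + i)) = \<dots>" .
      moreover have "(\<Sum>i\<in>{1..<Suc (n + 1 - s)}. F2 s (p + i)) + (\<Sum>i\<in>{1..<Suc s}. F2 s (p + (n + 1 - s) + i)) =
          (\<Sum>i\<in>{1..<Suc (n + 1)}. F2 s (p + i))"
        using sum_shift_from_1[where F = "\<lambda>i. F2 s (p + i)" and a = "n + 1 - s" and b = s]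
        unfolding e add.assoc .
      ultimately show ?thesis
        unfolding add.assoc e by (simp add: field_simps del: sum.op_ivl_Suc)
    qed
    have "X (2 * l - 1) + X (2 * l) =
      (\<Sum>s\<in>{1..<n}. ((\<Sum>i\<in>{1..<Suc (n + 1 - s)}. F1 s (p + i)) - F1 s (p + 1) / 2) +
        ((\<Sum>i\<in>{1..<Suc (s + 1)}. F1 s (p + (n + 1 - s) + i)) - F1 s (p + (n + 1 - s) + (s + 1)) / 2)) +
      (\<Sum>s\<in>{1..<n}. ((\<Sum>i\<in>{1..<Suc (n + 1 - s)}. F2 s (p + i)) - F2 s (p + (n + 1 - s)) / 2) +
        ((\<Sum>i\<in>{1..<Suc (s + 1)}. F2 s (p + (n - s) + i)) - F2 s (p + (n - s) + 1) / 2))"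
      unfolding Xodd Xeven by (simp only: sum.distrib ac_simps)
    also have "\<dots> = (\<Sum>s\<in>{1..<n}. (\<Sum>i\<in>{1..<Suc (n + 1)}. F1 s (p + i)) +
          (F1 s (p + (n + 1 + 1)) - F1 s (p + 1)) / 2) +
        (\<Sum>s\<in>{1..<n}. \<Sum>i\<in>{1..<Suc (n + 1)}. F2 s (p + i))"
      by (intro arg_cong2[where f = "(+)"] sum.cong refl F1_sum F2_sum)
    finally show ?thesis unfolding p_def .
  qed
  have "(\<Sum>l\<in>{1..<Suc k}. X l) = (\<Sum>l\<in>{1..<Suc k'}. X (2 * l - 1) + X (2 * l))"
    unfolding assms(1) by (rule sum_pairs)
  also have "\<dots> = (\<Sum>l\<in>{1..<Suc k'}. 
    (\<Sum>s\<in>{1..<n}. (\<Sum>i\<in>{1..<Suc (n + 1)}. F1 s ((l - 1) * (n + 1) + i)) +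
        (F1 s ((l - 1) * (n + 1) + (n + 1 + 1)) - F1 s ((l - 1) * (n + 1) + 1)) / 2) +
    (\<Sum>s\<in>{1..<n}. \<Sum>i\<in>{1..<Suc (n + 1)}. F2 s ((l - 1) * (n + 1) + i)))"
    by (intro sum.cong refl pair) auto
  also have "\<dots> = (\<Sum>s\<in>{1..<n}. \<Sum>i\<in>{1..<Suc m}. F1 s i) + (\<Sum>s\<in>{1..<n}. \<Sum>i\<in>{1..<Suc m}. F2 s i)"
    unfolding sum.distrib sum.swap[where A = "{1..<Suc k'}" and B = "{1..<n}"]
      sum_block_ends[of "F1 _", OF F1_per(1)] sum_blocks m_def by simp
  finally show ?thesis
    unfolding X_def
    by (simp only: sum_cyclic_shift[of "F1 _", OF F1_per(2)] sum_cyclic_shift[of "F2 _", OF F2_per])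
       (simp only: F1_def F2_def)
qed


section \<open>The isomorphism\<close>

lemma arrow_sum_Qm:
  "arrow_sum (Qm_arrows T n m) G =
     (\<Sum>s\<in>{1..<Suc n}. \<Sum>i\<in>{0..<m}. G (QV s (i mod m)) (QV s ((i + 1) mod m))) +
     ((\<Sum>(t, s) \<leftarrow> coxeter_arrows T n. \<Sum>i\<in>{0..<m}. G (QV t (i mod m)) (QV s (i mod m))) +
      (\<Sum>(t, s) \<leftarrow> coxeter_arrows T n. \<Sum>i\<in>{0..<m}. G (QV s ((i + 1) mod m)) (QV t (i mod m))))"
proof -
  \<comment> \<open>Reduction modulo \<open>m\<close> is the identity on this range; it brings the
    sums into the periodic form obtained from the triangles.\<close>
  have "(\<Sum>i\<in>{0..<m}. g i) = (\<Sum>i\<in>{0..<m}. g (i mod m))" for g :: "nat \<Rightarrow> rat"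
    by (intro sum.cong) auto
  note this[of "\<lambda>i. G (QV _ i) (QV _ ((i + 1) mod m))"] this[of "\<lambda>i. G (QV _ i) (QV _ i)"]
    this[of "\<lambda>i. G (QV _ ((i + 1) mod m)) (QV _ i)"]
  then show ?thesis
    unfolding Qm_arrows_def
    by (simp add: arrow_sum_concat_upt arrow_sum_map_upt arrow_sum_coxeter_pairs mod_Suc_eq
        del: upt_Suc sum.op_ivl_Suc)
qed

lemma sum_coxeter_arrows_A:
  "(\<Sum>(t, s) \<leftarrow> coxeter_arrows An n. X t s) = (\<Sum>s\<in>{1..<n}. X (s + 1) s :: rat)"
  by (simp add: coxeter_arrows_def comp_def interv_sum_list_conv_sum_set_nat)

section \<open>Arrows at the y vertices and comparison of all arrows\<close>

lemma arrow_sum_y_half_arrows: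
  "arrow_sum (y_half_arrows T n y) (\<lambda>x y. G (g x) (g y)) = arrow_sum (y_half_arrows T n (\<lambda>i. g (y i))) G"
  by (simp add: y_half_arrows_def arrow_sum_map_upt)

text \<open>These arrows already agree triangle by triangle, because the offset in the target quiver
  is \<open>disk_pos\<close>.\<close>

lemma arrow_sum_disk_y_notA:
  assumes "T \<noteq> An"
  shows "arrow_sum (tri_y_arrows T n @ y_half_arrows T n Y)
      (\<lambda>x y. G (tri_label T n k l x) (tri_label T n k l y)) =
    arrow_sum (Qt_y_arrows T n (k * coxeter_number T n div 2) l) G"
proof -
  define q m where "q = coxeter_number T n div 2" and "m = k * coxeter_number T n div 2"
  have V: "tri_label T n k l (V s i) = QV s (((l - 1) * q + i) mod m)" for s i
    using assms by (simp add: tri_label_simps disk_pos_def q_def m_def)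
  have Y: "tri_label T n k l (Y j) = QY l j" for j
    using assms by (simp add: tri_label_simps)
  \<comment> \<open>Subtracting one before or after adding the offset gives the same index as
    \<open>i \<ge> 3\<close>.\<close>
  have D: "(\<Sum>i\<in>{3..<Suc n}. G (QY l i) (QV n (((l - 1) * q + (i - 1)) mod m))) =
      (\<Sum>i\<in>{3..<Suc n}. G (QY l i) (QV n (((l - 1) * q + i - 1) mod m)))"
    by (intro sum.cong) auto
  have halves: "arrow_sum (y_half_arrows T n Y) (\<lambda>x y. G (tri_label T n k l x) (tri_label T n k l y)) =
      arrow_sum (y_half_arrows T n (QY l)) G"
    by (simp add: arrow_sum_y_half_arrows Y)
  show ?thesis
    unfolding arrow_sum_simps(3) halves m_def[symmetric]
    using assms D V Y unfolding q_def
    by (cases T)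
       (simp_all add: Let_def arrow_sum_map_upt del: upt_Suc sum.op_ivl_Suc coxeter_number.simps)
qed

text \<open>Only row \<open>1\<close> is joined to the y vertices. On the even triangle it becomes
  row \<open>n\<close> with offset \<open>p + 1\<close>, which accounts for the additional one in
  the target indices at \<open>QY'\<close>.\<close>

lemma arrow_sum_disk_y_A:
  assumes "k = 2 * k'" "l \<ge> 1"
  shows "arrow_sum (tri_y_arrows An n @ y_half_arrows An n Y)
      (\<lambda>x y. G (tri_label An n k (2 * l - 1) x) (tri_label An n k (2 * l - 1) y)) +
    arrow_sum (tri_y_arrows An n @ y_half_arrows An n Y)
      (\<lambda>x y. G (tri_label An n k (2 * l) x) (tri_label An n k (2 * l) y)) =
    arrow_sum (Qt_y_arrows An n (k' * (n + 1)) l) G"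
proof -
  define p m l' where "p = (l - 1) * (n + 1)" and "m = k' * (n + 1)" and "l' = 2 * l - 1"
  have mk: "k * coxeter_number An n div 2 = m" using assms by (simp add: m_def)
  have "odd l'" "l' div 2 = l - 1" "Suc l' div 2 = l" using assms(2) by (auto simp: l'_def)
  then have odd: "tri_label An n k l' (V s i) = QV s ((p + i) mod m)"
      "tri_label An n k l' (Y j) = QY l j" for s i j
    unfolding tri_label_simps mk by (simp_all add: disk_pos_def p_def)
  have "l * (n + 1) = p + (n + 1)" using assms(2) by (cases l) (auto simp: p_def)
  then have even: "tri_label An n k (2 * l) (V 1 i) = QV n ((p + 1 + i) mod m)"
      "tri_label An n k (2 * l) (Y j) = QY' l j" for i j
    unfolding tri_label_simps mk by (simp_all add: disk_pos_def Let_def)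
  show ?thesis
    unfolding m_def[symmetric] l'_def[symmetric]
    by (simp add: Let_def arrow_sum_map_upt arrow_sum_y_half_arrows odd even[unfolded One_nat_def]
        p_def del: upt_Suc sum.op_ivl_Suc)
qed

lemma arrow_sum_disk_label:
  assumes "dynkin_rank_ok T n" "T = An \<longrightarrow> even k"
  defines "m \<equiv> k * coxeter_number T n div 2"
  shows "arrow_sum (push_arrows (disk_label T n k) (disk_arrows T n k)) G =
    arrow_sum (Qm_arrows T n m @
      concat (map (Qt_y_arrows T n m) [1..<(if T = An then k div 2 else k) + 1])) G"
proof -
  let ?H = "\<lambda>l x y. G (tri_label T n k l x) (tri_label T n k l y)"
  have "arrow_sum (push_arrows (disk_label T n k) (disk_arrows T n k)) G =
     (\<Sum>l\<in>{1..<Suc k}. arrow_sum (tri_row_arrows T n) (?H l)) +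
     ((\<Sum>l\<in>{1..<Suc k}. arrow_sum (tri_coxeter_arrows T n) (?H l)) +
     (\<Sum>l\<in>{1..<Suc k}. arrow_sum (tri_y_arrows T n @ y_half_arrows T n Y) (?H l)))"
    unfolding arrow_sum_disk tri_arrows_def arrow_sum_simps(3) sum.distrib ..
  also have "\<dots> = arrow_sum (Qm_arrows T n m) G +
     (\<Sum>l\<in>{1..<Suc k}. arrow_sum (tri_y_arrows T n @ y_half_arrows T n Y) (?H l))"
  proof (cases "T = An")
    case True
    with assms obtain k' where k': "k = 2 * k'" by auto
    then have "m = k' * (n + 1)" using True by (simp add: m_def)
    with True arrow_sum_disk_coxeter_A[OF k', of n G] arrow_sum_disk_rows[OF assms(1,2), of G] show ?thesis
      unfolding arrow_sum_Qm m_def[symmetric]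
      by (simp add: sum_coxeter_arrows_A del: sum.op_ivl_Suc)
  next
    case False
    show ?thesis
      unfolding arrow_sum_Qm arrow_sum_disk_coxeter_notA[OF assms(1) False, of G k]
        arrow_sum_disk_rows[OF assms(1,2), of G] m_def by simp
  qed
  also have "(\<Sum>l\<in>{1..<Suc k}. arrow_sum (tri_y_arrows T n @ y_half_arrows T n Y) (?H l)) =
      arrow_sum (concat (map (Qt_y_arrows T n m) [1..<(if T = An then k div 2 else k) + 1])) G"
  proof (cases "T = An")
    case True
    with assms obtain k' where k': "k = 2 * k'" by auto
    have mk: "m = k' * (n + 1)" using True k' by (simp add: m_def)
    have "(\<Sum>l\<in>{1..<Suc k}. arrow_sum (tri_y_arrows T n @ y_half_arrows T n Y) (?H l)) =
       (\<Sum>l\<in>{1..<Suc k'}. arrow_sum (tri_y_arrows T n @ y_half_arrows T n Y) (?H (2 * l - 1)) +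
          arrow_sum (tri_y_arrows T n @ y_half_arrows T n Y) (?H (2 * l)))"
      unfolding k' by (rule sum_pairs)
    also have "\<dots> = (\<Sum>l\<in>{1..<Suc k'}. arrow_sum (Qt_y_arrows An n (k' * (n + 1)) l) G)"
      unfolding True by (intro sum.cong refl arrow_sum_disk_y_A[OF k']) auto
    finally show ?thesis
      using True k' unfolding mk by (simp add: arrow_sum_concat_upt del: upt_Suc sum.op_ivl_Suc)
  next
    case False
    then show ?thesis
      unfolding arrow_sum_disk_y_notA[OF False] m_def
      by (simp add: arrow_sum_concat_upt del: upt_Suc sum.op_ivl_Suc)
  qed
  finally show ?thesis by simp
qed

section \<open>Integrality and frozen vertices\<close>

lemma Qm_arrows_coeff: "(x, y, c) \<in> set (Qm_arrows T n m) \<Longrightarrow> c = 1"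
  by (auto simp: Qm_arrows_def)

lemma Qt_y_arrows_coeff:
  "(x, y, c) \<in> set (Qt_y_arrows T n m l) \<Longrightarrow> c = 1 \<or> x \<notin> range (\<lambda>(s, i). QV s i) \<and> y \<notin> range (\<lambda>(s, i). QV s i)"
  by (cases T) (auto simp: Let_def y_half_arrows_def split: if_splits)

lemma QV_notin_Qt_frozen: "QV s i \<notin> Qt_frozen T n k"
  by (auto simp: Qt_frozen_def)

text \<open>Coefficients other than \<open>1\<close> occur only between two y vertices, so every
  arrow number at a row vertex is an integer.\<close>

lemma sigma_Qtilde_Ints: "sigma (Qtilde T n k) (QV s i) b \<in> \<int>"
proof -
  have "c \<in> \<int>" if "(x, y, c) \<in> set (Qm_arrows T n m @ concat (map (Qt_y_arrows T n m) ls))"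
    "x = QV s i \<or> y = QV s i" for x y c m ls
  proof -
    have "QV s i \<in> range (\<lambda>(s, i). QV s i)" by (rule range_eqI[of _ _ "(s, i)"]) simp
    then have "c = 1" using that Qm_arrows_coeff Qt_y_arrows_coeff by fastforce
    then show ?thesis by simp
  qed
  then have "arrow_number (Qm_arrows T n m @ concat (map (Qt_y_arrows T n m) ls)) (QV s i) b \<in> \<int>"
    "arrow_number (Qm_arrows T n m @ concat (map (Qt_y_arrows T n m) ls)) b (QV s i) \<in> \<int>" for m ls
    by (blast intro: arrow_number_Ints)+
  then show ?thesis
    unfolding Qtilde_def Let_def quiver_of_def wquiver.select_convs
    by (intro Ints_diff)
qed

lemma sigma_Qtilde:
  assumes "dynkin_rank_ok T n" "T = An \<longrightarrow> even k"
  shows "sigma (Qtilde T n k) a b =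
    arrow_number (push_arrows (disk_label T n k) (disk_arrows T n k)) a b -
    arrow_number (push_arrows (disk_label T n k) (disk_arrows T n k)) b a"
  unfolding arrow_number_eqI[OF arrow_sum_disk_label[OF assms]]
  by (simp add: Qtilde_def Let_def quiver_of_def)

lemma weight_disk_label:
  assumes "x \<in> verts (disk_triangles T n k)"
  shows "weight (Qtilde T n k) (disk_label T n k x) = weight (disk_triangles T n k) x"
  using assms
  by (cases rule: disk_verts_cases)
     (auto simp: Qtilde_def Let_def quiver_of_def disk_triangles_def disjoint_union_def
       weight_disk_triangle row_vert_def y_vert_def)

text \<open>A first vertex is glued on its own triangle's turn, a last vertex on that of the
  cyclically next triangle.\<close>

lemma row_end_in_Field:
  assumes "l \<in> {1..k}" "s \<in> {1..n}" "i = 1 \<or> i = row_length T n l s"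
  shows "(l, row_vert T l s i) \<in> Field (disk_gluing T n k)"
proof -
  define l' where "l' = (if l = k then 1 else Suc l)"
  have l': "l' \<in> {1..k}" "prev_triangle k l' = l"
    using assms(1) by (auto simp: l'_def prev_triangle_def)
  have first: "(u, row_vert T u s 1) \<in> Range (disk_gluing T n k)"
    "(prev_triangle k u, row_vert T (prev_triangle k u) s (row_length T n (prev_triangle k u) s))
      \<in> Domain (disk_gluing T n k)" if "u \<in> {1..k}" for u
    using assms(2) that unfolding disk_gluing_eq by blast+
  show ?thesis
    using assms(3) first(1)[OF assms(1)] first(2)[OF l'(1)] l'(2) by (auto simp: Field_def)
qed

lemma disk_label_Field:
  assumes "x \<in> Field (disk_gluing T n k)"
  obtains s i where "disk_label T n k x = QV s i"
  using assms unfolding disk_gluing_eq by (auto simp: Field_def disk_label_row_vert)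

text \<open>A y vertex takes no part in the gluing and stays frozen. A class of frozen row vertices
  consists of row ends; it is therefore glued, its arrow numbers are integers, and it becomes
  unfrozen.\<close>

lemma frozen_disk_label:
  assumes "dynkin_rank_ok T n" "k \<ge> 1" "T = An \<longrightarrow> even k" "a \<in> verts (Qtilde T n k)"
  defines "X \<equiv> {x \<in> verts (disk_triangles T n k). disk_label T n k x = a}"
  shows "a \<in> frozen (Qtilde T n k) \<longleftrightarrow>
    X \<subseteq> frozen (disk_triangles T n k) \<and>
    \<not> (X \<inter> Field (disk_gluing T n k) \<noteq> {} \<and> (\<forall>b\<in>verts (Qtilde T n k). sigma (Qtilde T n k) a b \<in> \<int>))"
proof -
  have vQ: "verts (Qtilde T n k) = disk_label T n k ` verts (disk_triangles T n k)"
    unfolding disk_label_image[OF assms(1-3)] by (simp add: Qtilde_def Let_def quiver_of_def)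
  have fQ: "frozen (Qtilde T n k) = Qt_frozen T n k"
    by (simp add: Qtilde_def Let_def quiver_of_def)
  have frozen: "frozen (disk_triangles T n k) = (SIGMA l:{1..k}. frozen (disk_triangle T n l))"
    by (simp add: disk_triangles_def disjoint_union_def)
  show ?thesis
  proof (cases "a \<in> Qt_frozen T n k")
    case True
    have "x \<in> frozen (disk_triangles T n k)" if x: "x \<in> verts (disk_triangles T n k)" "disk_label T n k x = a" for x
      using x(1)
    proof (cases rule: disk_verts_cases)
      case (row l s i)
      then show ?thesis using x(2) True QV_notin_Qt_frozen by (auto simp: disk_label_row_vert)
    next
      case (y l j)
      then show ?thesis by (auto simp: frozen frozen_disk_triangle)
    qed
    moreover have "X \<inter> Field (disk_gluing T n k) = {}"
      using True QV_notin_Qt_frozen unfolding X_def by (auto elim: disk_label_Field)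
    ultimately show ?thesis using True fQ by (auto simp: X_def)
  next
    case False
    then obtain s i where a: "a = QV s i"
      using assms(4) by (auto simp: Qtilde_def Let_def quiver_of_def Qm_verts_def)
    have "X \<inter> Field (disk_gluing T n k) \<noteq> {}" if sub: "X \<subseteq> frozen (disk_triangles T n k)"
    proof -
      obtain x where x: "x \<in> verts (disk_triangles T n k)" "disk_label T n k x = a"
        using assms(4) vQ by auto
      then have xX: "x \<in> X" by (simp add: X_def)
      from x(1) show ?thesis
      proof (cases rule: disk_verts_cases)
        case (row l s i)
        have "(l, row_vert T l s i) \<in> frozen (disk_triangles T n k)" using sub xX row by auto
        moreover have "row_vert T l s i \<noteq> y_vert T l j" for j
          by (simp add: row_vert_def y_vert_def)
        ultimately have "i = 1 \<or> i = row_length T n l s"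
          unfolding frozen frozen_disk_triangle by (auto simp: row_vert_eq_iff)
        then show ?thesis using row_end_in_Field[of l k s n i T] row xX by blast
      next
        case (y l j)
        then show ?thesis using x(2) a by (auto simp: y_vert_def split: if_splits)
      qed
    qed
    then show ?thesis
      using False fQ a sigma_Qtilde_Ints by blast
  qed
qed

section \<open>Cycles around the puncture and the final isomorphism\<close>

lemma coxeter_arrows_irrefl: "(t, s) \<in> set (coxeter_arrows T n) \<Longrightarrow> t \<noteq> s"
  by (auto simp: coxeter_arrows_def split: if_splits)

text \<open>Coxeter arrows join different rows, so between vertices of one row only the row arrows
  remain; hence the full subquiver on a row is the bare cycle.\<close>

lemma arrow_number_Qm_row:
  assumes "s \<in> {1..n}"
  shows "arrow_number (Qm_arrows T n m) (QV s a) (QV s b) =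
    arrow_number (map (\<lambda>i. (QV s (i mod m), QV s ((i + 1) mod m), 1)) [0..<m]) (QV s a) (QV s b)"
proof -
  define G :: "qvert \<Rightarrow> qvert \<Rightarrow> rat" where "G = (\<lambda>x y. if x = QV s a \<and> y = QV s b then 1 else 0)"
  have zero: "(\<Sum>(t, r) \<leftarrow> ps. X t r) = (0 :: rat)"
    if "\<And>t r. (t, r) \<in> set ps \<Longrightarrow> X t r = 0" for ps and X :: "nat \<Rightarrow> nat \<Rightarrow> rat"
    using that by (induction ps) auto
  have "(\<Sum>(t, r) \<leftarrow> coxeter_arrows T n. \<Sum>i\<in>{0..<m}. G (QV t (i mod m)) (QV r (i mod m))) = 0"
    "(\<Sum>(t, r) \<leftarrow> coxeter_arrows T n. \<Sum>i\<in>{0..<m}. G (QV r ((i + 1) mod m)) (QV t (i mod m))) = 0"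
    by (auto intro!: zero sum.neutral simp: G_def dest: coxeter_arrows_irrefl)
  moreover have "(\<Sum>r\<in>{1..<Suc n}. \<Sum>i\<in>{0..<m}. G (QV r (i mod m)) (QV r ((i + 1) mod m))) =
      (\<Sum>r\<in>{1..<Suc n}. if r = s then \<Sum>i\<in>{0..<m}. G (QV s (i mod m)) (QV s ((i + 1) mod m)) else 0)"
    by (intro sum.cong) (auto simp: G_def intro!: sum.neutral)
  ultimately have "arrow_sum (Qm_arrows T n m) G =
      (\<Sum>i\<in>{0..<m}. G (QV s (i mod m)) (QV s ((i + 1) mod m)))"
    using assms unfolding arrow_sum_Qm by (simp add: less_Suc_eq_le del: sum.op_ivl_Suc)
  then show ?thesis
    unfolding arrow_number_eq_arrow_sum G_def[symmetric] arrow_sum_map_upt by simp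
qed

theorem proposition5p27:
  fixes T :: dynkin_type and n k :: nat
  assumes "dynkin_rank_ok T n" and "k \<ge> 1" and "T = An \<Longrightarrow> even k"
  shows "\<exists>\<phi>. quiver_iso \<phi> (chart_quiver T n k) (Qtilde T n k) \<and>
    (\<forall>s\<in>{1..n}.
       quiver_iso \<phi> (puncture_cycle T n k s)
         (full_subquiver (Qm T n (k * coxeter_number T n div 2))
            {QV s i | i. i < k * coxeter_number T n div 2}))"
proof -
  let ?D = "disk_triangles T n k" and ?R = "disk_gluing T n k" and ?f = "disk_label T n k"
  define m where "m = k * coxeter_number T n div 2"
  have ev: "T = An \<longrightarrow> even k" using assms(3) by blast
  have glue: "glue_rel ?D ?R = {(x, y). x \<in> verts ?D \<and> y \<in> verts ?D \<and> ?f x = ?f y}"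
    using disk_gluing_label[OF assms(1) ev] disk_label_glue[OF assms(1) ev]
    by (intro glue_rel_eq_fibres disk_gluing_verts[OF assms(1)]) auto
  define \<phi> where "\<phi> = (\<lambda>X. the_elem (?f ` X))"
  have vQ: "verts (Qtilde T n k) = ?f ` verts ?D"
    unfolding disk_label_image[OF assms(1,2) ev] by (simp add: Qtilde_def Let_def quiver_of_def)
  have iso: "quiver_iso \<phi> (chart_quiver T n k) (Qtilde T n k)"
    unfolding chart_quiver_def \<phi>_def
    by (rule quiver_iso_amalgamate[where as = "disk_arrows T n k"])
       (use disk_arrows_verts[OF assms(1)] glue vQ sigma_Qtilde[OF assms(1) ev]
          frozen_disk_label[OF assms(1,2) ev] in
        \<open>auto simp only: finite_verts_disk_triangles sigma_disk_triangles weight_disk_label\<close>)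
  have cv: "\<phi> (chart_vert T n k x) = ?f x" "chart_vert T n k x \<in> verts (chart_quiver T n k)"
    if "x \<in> verts ?D" for x
  proof -
    have "?f ` chart_vert T n k x = {?f x}"
      using that unfolding chart_vert_def glue by auto
    then show "\<phi> (chart_vert T n k x) = ?f x" by (simp add: \<phi>_def)
    show "chart_vert T n k x \<in> verts (chart_quiver T n k)"
      using that by (auto simp: chart_quiver_def amalgamate_def Let_def chart_vert_def quotient_def)
  qed
  have "quiver_iso \<phi> (puncture_cycle T n k s) (full_subquiver (Qm T n m) {QV s i | i. i < m})"
    if s: "s \<in> {1..n}" for s
  proof -
    define cv where "cv = (\<lambda>l i. chart_vert T n k (l, row_vert T l s i))"
    define I where "I = {cv l i | l i. l \<in> {1..k} \<and> i \<in> {1..row_length T n l s}}"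
    define L :: "(nat \<times> tvert) set arrows" where
      "L = [(cv l i, cv l (i + 1), 1). l \<leftarrow> [1..<k+1], i \<leftarrow> [1..<row_length T n l s]]"
    have P: "puncture_cycle T n k s =
        quiver_of I (frozen (chart_quiver T n k) \<inter> I) (weight (chart_quiver T n k)) L"
      by (simp add: puncture_cycle_def Let_def cv_def I_def L_def)
    have \<phi>_cv: "\<phi> (cv l i) = QV s ((disk_pos T n l s + i) mod m)" "cv l i \<in> verts (chart_quiver T n k)"
      if "l \<in> {1..k}" "i \<in> {1..row_length T n l s}" for l i
      using cv[OF row_vert_in_disk[OF that(1) s that(2)]]
      by (simp_all add: cv_def disk_label_row_vert m_def)
    have I_sub: "I \<subseteq> verts (chart_quiver T n k)"
      using \<phi>_cv(2) by (auto simp: I_def)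
    \<comment> \<open>Injectivity on the cycle is inherited from the isomorphism of the whole
      chart.\<close>
    then have inj: "inj_on \<phi> I"
      using iso by (auto simp: quiver_iso_def bij_betw_def intro: inj_on_subset)
    have "m > 0" using modulus_pos assms(1,2) by (simp add: m_def)
    have im: "\<phi> ` I = {QV s i | i. i < m}"
    proof
      show "\<phi> ` I \<subseteq> {QV s i | i. i < m}"
        using \<phi>_cv(1) \<open>m > 0\<close> by (auto simp: I_def)
      show "{QV s i | i. i < m} \<subseteq> \<phi> ` I"
      proof clarify
        fix i assume "i < m"
        \<comment> \<open>The labelling is onto, and a vertex with this label must lie in row
          \<open>s\<close>.\<close>
        then have "QV s i \<in> ?f ` verts ?D"
          using s unfolding disk_label_image[OF assms(1,2) ev] by (auto simp: Qm_verts_def m_def)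
        then obtain x where x: "x \<in> verts ?D" "?f x = QV s i" by auto
        from x(1) show "QV s i \<in> \<phi> ` I"
        proof (cases rule: disk_verts_cases)
          case (row l s' i')
          then have "s' = s" using x(2) by (simp add: disk_label_row_vert)
          with row x \<phi>_cv(1)[of l i'] show ?thesis
            by (intro image_eqI[where x = "cv l i'"]) (auto simp: I_def disk_label_row_vert m_def)
        next
          case (y l j)
          then show ?thesis using x(2) by (auto simp: y_vert_def split: if_splits)
        qed
      qed
    qed
    have L_verts: "a \<in> I \<and> b \<in> I" if "(a, b, c) \<in> set L" for a b c
      using that by (fastforce simp: L_def I_def)
    \<comment> \<open>The steps of row \<open>s\<close> on all triangles tile one full turn.\<close>
    have L_sum: "arrow_sum (push_arrows \<phi> L) G =
        arrow_sum (map (\<lambda>i. (QV s (i mod m), QV s ((i + 1) mod m), 1)) [0..<m]) G" for G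
    proof -
      define F where "F = (\<lambda>j. G (QV s (j mod m)) (QV s ((j + 1) mod m)))"
      have "arrow_sum (push_arrows \<phi> L) G =
        (\<Sum>l\<in>{1..<Suc k}. \<Sum>i\<in>{1..<row_length T n l s}. G (\<phi> (cv l i)) (\<phi> (cv l (i + 1))))"
        unfolding L_def arrow_sum_push arrow_sum_concat_upt arrow_sum_map_upt by simp
      also have "\<dots> = (\<Sum>l\<in>{1..<Suc k}. \<Sum>i\<in>{1..<row_length T n l s}. F (disk_pos T n l s + i))"
        by (intro sum.cong refl) (auto simp: \<phi>_cv F_def)
      also have "\<dots> = (\<Sum>i\<in>{0..<m}. F i)"
        unfolding m_def using mod_add_self1[of m 1]
        by (intro sum_row_cycle[OF assms(1) ev s]) (auto simp: F_def m_def)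
      finally show ?thesis
        by (simp add: arrow_sum_map_upt F_def)
    qed
    have L_number: "arrow_number (Qm_arrows T n m) (\<phi> X) (\<phi> Y) = arrow_number L X Y"
      if "X \<in> I" "Y \<in> I" for X Y
    proof -
      have "\<phi> X \<in> {QV s i | i. i < m}" "\<phi> Y \<in> {QV s i | i. i < m}" using that im by auto
      then obtain a b where ab: "\<phi> X = QV s a" "\<phi> Y = QV s b" by auto
      have "arrow_number L X Y = arrow_number (push_arrows \<phi> L) (\<phi> X) (\<phi> Y)"
        using arrow_number_push_inj[OF L_verts inj that] by simp
      then show ?thesis
        unfolding arrow_number_eqI[OF L_sum] ab arrow_number_Qm_row[OF s] by simp
    qed
    have vs: "verts (Qm T n m) \<inter> {QV s i | i. i < m} = {QV s i | i. i < m}"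
      using s by (auto simp: Qm_def quiver_of_def Qm_verts_def)
    \<comment> \<open>Row vertices are not frozen in the target, so the isomorphism shows that the
      classes on the cycle are unfrozen, as in \<open>Qm\<close>.\<close>
    have "X \<notin> frozen (chart_quiver T n k)" "weight (chart_quiver T n k) X = qweight T (\<phi> X)"
      if "X \<in> I" for X
    proof -
      have "\<phi> X \<in> {QV s i | i. i < m}" using that im by auto
      moreover have "X \<in> verts (chart_quiver T n k)" using that I_sub by auto
      ultimately show "X \<notin> frozen (chart_quiver T n k)" "weight (chart_quiver T n k) X = qweight T (\<phi> X)"
        using iso QV_notin_Qt_frozen[of s _ T n k]
        by (auto simp: quiver_iso_def Qtilde_def Let_def quiver_of_def)
    qed
    then show ?thesis
      unfolding quiver_iso_def P bij_betw_def
      using inj im vs L_number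
      by (simp add: quiver_of_def full_subquiver_def Qm_def)
  qed
  with iso show ?thesis unfolding m_def by blast
qed

end
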